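(* Let $c_1,c_2\in\mathbb R$ and $p\in(0,1)$, $p\ne7/8$, be such that $\lambda^{(2)}_p(\Gamma^{(p)})<-\frac12<\lambda^{(1)}_p(\Gamma^{(p)})<0$ almost surely. Then there exists a finite random variable $L^{(p)}_{c_1,c_2}$ such that $$\frac{\big(c_1\nu^{(1)}_p(\Gamma^{(p)})+c_2\nu^{(2)}_p(\Gamma^{(p)})\big)^\top(\Gamma_n-\Gamma^{(p)})}{n^{\lambda^{(1)}_p(\Gamma^{(p)})}}\xrightarrow{\text{a.s.}}L^{(p)}_{c_1,c_2}.$$
   Context: A random variable is $\mathrm{Rad}(q)$ if it equals $+1$ with probability $q$ and $-1$ with probability $1-q$. Random walk with two memory channels with parameter $p\in(0,1)$: $S_0=0$; $X_1,X_2$ i.i.d. $\mathrm{Rad}(1/2)$; for $n\ge 2$, $U_{1,n+1},U_{2,n+1}$ i.i.d. uniform on $\{1,\dots,n\}$ and $\alpha_{1,n+1},\alpha_{2,n+1}$ i.i.d. $\mathrm{Rad}(p)$, all mutually independent and independent of $X_1,\dots,X_n$ (and earlier draws); $T_{n+1}=\alpha_{1,n+1}X_{U_{1,n+1}}+\alpha_{2,n+1}X_{U_{2,n+1}}$, $X_{n+1}=\max(-1,\min(1,T_{n+1}))$. $S_n^{\pm}$ = number of $\pm1$ steps among $X_1,\dots,X_n$, $\Gamma_n=(S_n^+/n,S_n^-/n)^\top$; for $p\ne7/8$, $\Gamma^{(p)}$ is the almost sure limit of $\Gamma_n$. $h_p(x)=\big(((1-p)x_1+px_2-1)^2-(1-x_1-x_2)^2-x_1,\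 ((1-p)x_2+px_1-1)^2-(1-x_1-x_2)^2-x_2\big)^\top$ on $[0,1]^2$, $J_p(x)$ its Jacobian; $\lambda^{(1)}_p(x)\ge\lambda^{(2)}_p(x)$ are the eigenvalues of $J_p(x)$, $\nu^{(i)}_p(x)$ corresponding eigenvectors with first coordinate $1$ (at $(1/3,1/3)^\top$: for $p\le1/2$, $\nu^{(1)}=(1,1)^\top,\nu^{(2)}=(1,-1)^\top$; for $1/2<p<7/8$ reversed). *)

theory Defs
  imports "HOL-Probability.Probability"
begin

definition clip :: "real \<Rightarrow> real" where
  "clip t = max (-1) (min 1 t)"

text \<open>Labels of the primitive random inputs of the walk:
  X_1, X_2 and, for m = n+1 \<ge> 3, U_{1,m}, U_{2,m}, alpha_{1,m}, alpha_{2,m}.\<close>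
datatype lbl = LX nat | LU1 nat | LU2 nat | LA1 nat | LA2 nat

definition prim_index :: "lbl set" where
  "prim_index = {LX 1, LX 2} \<union> (\<Union>m\<in>{3..}. {LU1 m, LU2 m, LA1 m, LA2 m})"

definition prim_vars ::
  "(nat \<Rightarrow> 'a \<Rightarrow> real) \<Rightarrow> (nat \<Rightarrow> 'a \<Rightarrow> nat) \<Rightarrow> (nat \<Rightarrow> 'a \<Rightarrow> nat)
   \<Rightarrow> (nat \<Rightarrow> 'a \<Rightarrow> real) \<Rightarrow> (nat \<Rightarrow> 'a \<Rightarrow> real) \<Rightarrow> lbl \<Rightarrow> 'a \<Rightarrow> real" where
  "prim_vars X U1 U2 A1 A2 i \<omega> = (case i of
      LX k \<Rightarrow> X k \<omega> | LU1 k \<Rightarrow> real (U1 k \<omega>) | LU2 k \<Rightarrow> real (U2 k \<omega>)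
    | LA1 k \<Rightarrow> A1 k \<omega> | LA2 k \<Rightarrow> A2 k \<omega>)"

definition Gamma_n :: "(nat \<Rightarrow> 'a \<Rightarrow> real) \<Rightarrow> nat \<Rightarrow> 'a \<Rightarrow> real \<times> real" where
  "Gamma_n X n \<omega> = (real (card {k\<in>{1..n}. X k \<omega> = 1}) / real n,
                     real (card {k\<in>{1..n}. X k \<omega> = -1}) / real n)"

definition h :: "real \<Rightarrow> real \<times> real \<Rightarrow> real \<times> real" where
  "h p x = (((1-p)* fst x + p * snd x - 1)\<^sup>2 - (1 - fst x - snd x)\<^sup>2 - fst x,
            ((1-p)* snd x + p * fst x - 1)\<^sup>2 - (1 - fst x - snd x)\<^sup>2 - snd x)"

definition J :: "real \<Rightarrow> real \<times> real \<Rightarrow> real \<times> real \<Rightarrow> real \<times> real" where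
  "J p x = (SOME f'. (h p has_derivative f') (at x))"

definition is_eigenvalue :: "(real \<times> real \<Rightarrow> real \<times> real) \<Rightarrow> real \<Rightarrow> bool" where
  "is_eigenvalue f l \<longleftrightarrow> (\<exists>v. v \<noteq> 0 \<and> f v = l *\<^sub>R v)"

definition lambda1 :: "real \<Rightarrow> real \<times> real \<Rightarrow> real" where
  "lambda1 p x = (GREATEST l. is_eigenvalue (J p x) l)"

definition lambda2 :: "real \<Rightarrow> real \<times> real \<Rightarrow> real" where
  "lambda2 p x = (LEAST l. is_eigenvalue (J p x) l)"

definition eigvec :: "real \<Rightarrow> real \<times> real \<Rightarrow> real \<Rightarrow> real \<times> real" where
  "eigvec p x l = (1, THE y. J p x (1, y) = l *\<^sub>R (1, y))"

definition nu1 :: "real \<Rightarrow> real \<times> real \<Rightarrow> real \<times> real" where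
  "nu1 p x = eigvec p x (lambda1 p x)"

definition nu2 :: "real \<Rightarrow> real \<times> real \<Rightarrow> real \<times> real" where
  "nu2 p x = eigvec p x (lambda2 p x)"

end

theory Submission
  imports Defs "HOL-Real_Asymp.Real_Asymp"
begin

text \<open>
  Write \<open>\<Gamma> (n+1) - \<Gamma> n = (h (\<Gamma> n) + S (n+1) - S n) / (n+1)\<close>, where \<open>S\<close> is the sum of the bounded
  martingale noise. An exponential moment bound and Borel--Cantelli give \<open>S n = O(n powr (1/2 + \<delta>))\<close>
  almost surely for every \<open>\<delta> > 0\<close>; the rest is pathwise. The process \<open>Z n = \<Gamma> n - G - S n / n\<close> satisfies
  \<open>Z (n+1) - Z n = (h (\<Gamma> n) + S n / n) / (n+1)\<close>, so divergence of the harmonic series forces \<open>h G = 0\<close>,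
  and in eigencoordinates of the Jacobian at \<open>G\<close> the recursion is linear up to errors that are
  quadratic or of order \<open>n powr (-1/2 + \<delta>)\<close>, both negligible against \<open>n powr \<lambda>1\<close> because \<open>-1/2 < \<lambda>1 < 0\<close>.
  Hence \<open>(\<Gamma> n - G) / n powr \<lambda>1\<close> converges as a vector, and so does every linear functional of it. As \<open>h\<close>
  has finitely many zeros, \<open>G\<close> takes finitely many values almost surely, which makes the eigenvectors
  at \<open>G\<close>, and thereby the limit, measurable.
\<close>

section \<open>Stochastic approximation along a path\<close>

text \<open>For negative \<open>x\<close> the cubic Lagrange remainder is nonpositive and
  \<open>x\<^sup>2 / 2 \<le> x\<^sup>2\<close>. The bound splits the exponential of a small
  increment into a linear term, which averages out, and a variance term.\<close>

lemma exp_le_quadratic: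
  fixes x :: real
  assumes "\<bar>x\<bar> \<le> 1"
  shows "exp x \<le> 1 + x + x\<^sup>2"
proof (cases "x \<ge> 0")
  case True
  then show ?thesis using assms exp_bound by auto
next
  case False
  obtain t where t: "exp x = (\<Sum>m<3. x ^ m / fact m) + exp t / fact 3 * x ^ 3"
    using Maclaurin_exp_le[of x 3] by blast
  have "exp t / fact 3 * x ^ 3 \<le> 0"
    using False by (intro mult_nonneg_nonpos) (auto simp: power3_eq_cube mult_nonneg_nonpos2 intro: mult_nonneg_nonpos)
  moreover have "(\<Sum>m<3. x ^ m / fact m) = 1 + x + x\<^sup>2 / 2"
    by (simp add: numeral_3_eq_3 power2_eq_square)
  ultimately show ?thesis
    using t zero_le_power2[of x] by linarith
qed

section \<open>Scalar recursions with step size \<open>1 / Suc n\<close>\<close>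

lemma summable_diff_imp_convergent:
  fixes v :: "nat \<Rightarrow> 'a :: real_normed_vector"
  assumes "summable (\<lambda>n. v (Suc n) - v n)"
  shows "convergent v"
proof -
  have "(\<lambda>n. (\<Sum>k<n. v (Suc k) - v k)) \<longlonglongrightarrow> (\<Sum>k. v (Suc k) - v k)"
    using assms by (rule summable_LIMSEQ)
  then have "(\<lambda>n. (v n - v 0) + v 0) \<longlonglongrightarrow> (\<Sum>k. v (Suc k) - v k) + v 0"
    unfolding sum_lessThan_telescope by (intro tendsto_intros)
  then show ?thesis by (auto simp: convergent_def)
qed

text \<open>After multiplication by \<open>n powr \<mu>\<close> the sequence grows by at most a
  summable amount per step, so it stays bounded. The gap \<open>\<mu> < \<mu>'\<close> absorbs the
  growth of the weight; the gap \<open>\<mu> < \<beta>\<close> makes the weighted error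
  summable.\<close>

lemma recursive_decay:
  fixes a :: "nat \<Rightarrow> real"
  assumes nonneg: "\<And>n. 0 \<le> a n"
    and rec: "\<forall>\<^sub>F n in sequentially. a (Suc n) \<le> (1 - \<mu>' / real (Suc n)) * a n + C * real n powr (-\<beta>) / real (Suc n)"
    and \<mu>: "0 < \<mu>" "\<mu> < 1" "\<mu> < \<mu>'" "\<mu> < \<beta>"
  shows "\<exists>K. \<forall>\<^sub>F n in sequentially. a n \<le> K * real n powr (-\<mu>)"
proof -
  define b where "b n = real n powr \<mu> * a n" for n
  define s where "s n = \<bar>C\<bar> * real n powr (\<mu> - \<beta> - 1)" for n
  have s_sum: "summable s"
    unfolding s_def using \<mu> by (intro summable_mult) (subst summable_real_powr_iff, simp)
  have s_nn: "0 \<le> s n" for n by (simp add: s_def)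
  \<comment> \<open>The weight grows by a relative amount of about \<open>\<mu> / n\<close>, which
    the contraction by \<open>\<mu>' / Suc n\<close> outweighs.\<close>
  have "\<forall>\<^sub>F n in sequentially. real (Suc n) powr \<mu> * (1 - \<mu>' / real (Suc n)) \<le> real n powr \<mu>"
    using \<mu> by real_asymp
  with rec eventually_gt_at_top[of 0]
  have "\<forall>\<^sub>F n in sequentially. b (Suc n) \<le> b n + s n"
  proof eventually_elim
    case (elim n)
    have "b (Suc n) \<le> real (Suc n) powr \<mu> * ((1 - \<mu>' / real (Suc n)) * a n + C * real n powr (-\<beta>) / real (Suc n))"
      unfolding b_def by (intro mult_left_mono elim) simp
    also have "\<dots> = (real (Suc n) powr \<mu> * (1 - \<mu>' / real (Suc n))) * a n
        + C * (real (Suc n) powr (\<mu> - 1) * real n powr (-\<beta>))"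
      by (simp add: algebra_simps powr_diff)
    \<comment> \<open>The exponent \<open>\<mu> - 1\<close> is negative, so replacing
      \<open>Suc n\<close> by \<open>n\<close> increases the power.\<close>
    also have "\<dots> \<le> real n powr \<mu> * a n + \<bar>C\<bar> * (real n powr (\<mu> - 1) * real n powr (-\<beta>))"
      using elim nonneg \<mu> by (intro add_mono mult_right_mono mult_mono powr_mono2') auto
    also have "\<dots> = b n + s n"
      by (simp add: b_def s_def algebra_simps flip: powr_add)
    finally show ?case .
  qed
  then obtain N where N: "\<And>n. n \<ge> N \<Longrightarrow> b (Suc n) \<le> b n + s n"
    by (auto simp: eventually_sequentially)
  have "b n \<le> b N + suminf s" if "n \<ge> N" for n
  proof -
    have "b n \<le> b N + sum s {N..<n}"
      using that
    proof (induction n rule: dec_induct)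
      case (step n)
      then show ?case using N[of n] by simp
    qed simp
    also have "sum s {N..<n} \<le> suminf s"
      by (intro sum_le_suminf s_sum s_nn) auto
    finally show ?thesis by simp
  qed
  then have "\<forall>\<^sub>F n in sequentially. b n \<le> b N + suminf s"
    by (auto simp: eventually_sequentially)
  with eventually_gt_at_top[of 0]
  have "\<forall>\<^sub>F n in sequentially. a n \<le> (b N + suminf s) * real n powr (-\<mu>)"
  proof eventually_elim
    case (elim n)
    have "a n = b n * real n powr (-\<mu>)"
      using elim by (simp add: b_def powr_minus field_simps)
    also have "\<dots> \<le> (b N + suminf s) * real n powr (-\<mu>)"
      using elim by (intro mult_right_mono) auto
    finally show ?case .
  qed
  then show ?thesis by blast
qed

text \<open>Here the weight has exactly the exponent \<open>m\<close> of the contraction, so the two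
  cancel to first order and leave \<open>d n = O(n powr (m - 2))\<close>, summable because
  \<open>m < 1\<close>; for this term boundedness of \<open>u\<close> suffices. The weighted
  residual is summable because \<open>m < \<gamma>\<close>. Hence \<open>n powr m * u n\<close> has
  absolutely summable increments.\<close>

lemma recursive_limit:
  fixes u r :: "nat \<Rightarrow> real"
  assumes rec: "\<forall>\<^sub>F n in sequentially. u (Suc n) = (1 - m / real (Suc n)) * u n + r n / real (Suc n)"
    and r: "\<forall>\<^sub>F n in sequentially. \<bar>r n\<bar> \<le> C * real n powr (-\<gamma>)"
    and u: "\<forall>\<^sub>F n in sequentially. \<bar>u n\<bar> \<le> K"
    and m: "0 < m" "m < 1" "m < \<gamma>"
  shows "convergent (\<lambda>n. real n powr m * u n)"
proof -
  define d where "d n = real (Suc n) powr m * (1 - m / real (Suc n)) - real n powr m" for n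
  define v where "v n = real n powr m * u n" for n
  have "d \<in> O(\<lambda>n. real n powr (m - 2))"
    unfolding d_def using m by real_asymp
  moreover have "summable (\<lambda>n. norm (real n powr (m - 2)))"
    using m by (simp, subst summable_real_powr_iff, simp)
  ultimately have "summable (\<lambda>n. \<bar>d n\<bar>)"
    using summable_comparison_test_bigo[of "\<lambda>n. real n powr (m - 2)" "\<lambda>n. \<bar>d n\<bar>"] by simp
  moreover have "summable (\<lambda>n. real n powr (m - \<gamma> - 1))"
    using m by (subst summable_real_powr_iff) simp
  ultimately have sum: "summable (\<lambda>n. \<bar>K\<bar> * \<bar>d n\<bar> + \<bar>C\<bar> * real n powr (m - \<gamma> - 1))"
    by (intro summable_add summable_mult)
  have "\<forall>\<^sub>F n in sequentially. norm (v (Suc n) - v n) \<le> \<bar>K\<bar> * \<bar>d n\<bar> + \<bar>C\<bar> * real n powr (m - \<gamma> - 1)"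
    using rec r u eventually_gt_at_top[of 0]
  proof eventually_elim
    case (elim n)
    have "v (Suc n) - v n = u n * d n + real (Suc n) powr (m - 1) * r n"
      unfolding v_def elim(1) d_def by (simp add: algebra_simps powr_diff)
    also have "\<bar>\<dots>\<bar> \<le> \<bar>u n\<bar> * \<bar>d n\<bar> + real (Suc n) powr (m - 1) * \<bar>r n\<bar>"
      by (intro order.trans[OF abs_triangle_ineq]) (simp add: abs_mult)
    also have "\<dots> \<le> \<bar>K\<bar> * \<bar>d n\<bar> + real n powr (m - 1) * (\<bar>C\<bar> * real n powr (-\<gamma>))"
    proof (intro add_mono mult_right_mono mult_mono)
      show "\<bar>r n\<bar> \<le> \<bar>C\<bar> * real n powr - \<gamma>"
        using elim(2) mult_right_mono[of C "\<bar>C\<bar>" "real n powr - \<gamma>"] by (meson abs_ge_self order.trans powr_ge_zero)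
    qed (use elim m in \<open>auto intro!: powr_mono2'\<close>)
    also have "\<dots> = \<bar>K\<bar> * \<bar>d n\<bar> + \<bar>C\<bar> * real n powr (m - \<gamma> - 1)"
      by (simp add: algebra_simps flip: powr_add)
    finally show ?case by simp
  qed
  then have "summable (\<lambda>n. v (Suc n) - v n)"
    using sum by (rule summable_comparison_test_ev)
  then show ?thesis
    unfolding v_def[abs_def, symmetric] by (rule summable_diff_imp_convergent)
qed

text \<open>The increments of a convergent sequence are summable, while a nonzero \<open>l\<close>
  would make them comparable to the harmonic series.\<close>

lemma tendsto_zero_if_harmonic_increments:
  fixes z c :: "nat \<Rightarrow> real"
  assumes z: "convergent z" and c: "c \<longlonglongrightarrow> l"
    and rec: "\<forall>\<^sub>F n in sequentially. z (Suc n) - z n = c n / real (Suc n)"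
  shows "l = 0"
proof (rule ccontr)
  assume "l \<noteq> 0"
  from z obtain z0 where "z \<longlonglongrightarrow> z0" by (auto simp: convergent_def)
  \<comment> \<open>The factor \<open>2 / l\<close> removes the sign of \<open>l\<close> and
    compensates the lower bound \<open>1/2\<close> on \<open>c n / l\<close> below.\<close>
  then have s: "summable (\<lambda>n. (2 / l) * (z (Suc n) - z n))"
    by (intro summable_mult telescope_summable)
  have "(\<lambda>n. c n / l) \<longlonglongrightarrow> l / l"
    using c \<open>l \<noteq> 0\<close> by (intro tendsto_intros)
  then have "\<forall>\<^sub>F n in sequentially. c n / l > 1/2"
    using \<open>l \<noteq> 0\<close> by (intro order_tendstoD) auto
  with rec have "\<forall>\<^sub>F n in sequentially. norm (1 / real (Suc n)) \<le> (2 / l) * (z (Suc n) - z n)"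
  proof eventually_elim
    case (elim n)
    have "1 / real (Suc n) \<le> (2 * (c n / l)) / real (Suc n)"
      using elim(2) by (intro divide_right_mono) (linarith, simp)
    then show ?case unfolding elim(1) by (simp add: mult.commute mult.left_commute)
  qed
  then have "summable (\<lambda>n. 1 / real (Suc n))"
    using s by (rule summable_comparison_test_ev)
  then have "summable (\<lambda>n. 1 / real n)"
    by (subst (asm) summable_Suc_iff)
  then have "summable (\<lambda>n. real n powr (-1))"
    by (simp add: powr_minus divide_inverse)
  then show False by (subst (asm) summable_real_powr_iff) simp
qed

section \<open>Averaging out the noise, and the rate of convergence\<close>

text \<open>Summation by parts: since \<open>1 / n - 1 / Suc n = 1 / (n * Suc n)\<close>,
  subtracting \<open>E n\<close> from \<open>x n\<close> trades the increment of \<open>S\<close>,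
  which does not shrink, for the average \<open>E n\<close>, which does when \<open>S\<close> grows
  sublinearly.\<close>

lemma averaged_noise_recursion:
  fixes x S c :: "nat \<Rightarrow> 'a :: real_normed_vector"
  defines "E \<equiv> \<lambda>n. (1 / real n) *\<^sub>R S n"
  assumes "x (Suc n) - x n = (1 / real (Suc n)) *\<^sub>R (c n + S (Suc n) - S n)" "n > 0"
  shows "(x (Suc n) - E (Suc n)) - (x n - E n) = (1 / real (Suc n)) *\<^sub>R (c n + E n)"
proof -
  have "E n - (1 / real (Suc n)) *\<^sub>R S n = (1 / real n - 1 / real (Suc n)) *\<^sub>R S n"
    by (simp add: E_def scaleR_diff_left)
  also have "1 / real n - 1 / real (Suc n) = (1 / real (Suc n)) * (1 / real n)"
    using assms by (simp add: field_simps)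
  finally have E: "E n - (1 / real (Suc n)) *\<^sub>R S n = (1 / real (Suc n)) *\<^sub>R E n"
    by (simp add: E_def)
  have "(x (Suc n) - E (Suc n)) - (x n - E n) = (x (Suc n) - x n) - (1 / real (Suc n)) *\<^sub>R S (Suc n) + E n"
    by (simp add: E_def)
  also have "\<dots> = (1 / real (Suc n)) *\<^sub>R c n + (E n - (1 / real (Suc n)) *\<^sub>R S n)"
    unfolding assms by (simp add: scaleR_add_right scaleR_diff_right)
  also have "\<dots> = (1 / real (Suc n)) *\<^sub>R (c n + E n)"
    unfolding E by (simp add: scaleR_add_right)
  finally show ?thesis .
qed

lemma stochastic_approximation_drift_zero:
  fixes x S c :: "nat \<Rightarrow> real"
  assumes rec: "\<forall>\<^sub>F n in sequentially. x (Suc n) - x n = (1 / real (Suc n)) *\<^sub>R (c n + S (Suc n) - S n)"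
    and x: "convergent x" and c: "c \<longlonglongrightarrow> l" and S: "(\<lambda>n. (1 / real n) *\<^sub>R S n) \<longlonglongrightarrow> 0"
  shows "l = 0"
proof (rule tendsto_zero_if_harmonic_increments)
  show "convergent (\<lambda>n. x n - (1 / real n) *\<^sub>R S n)"
    using x S by (intro convergent_diff) (auto simp: convergent_def)
  show "(\<lambda>n. c n + (1 / real n) *\<^sub>R S n) \<longlonglongrightarrow> l"
    using tendsto_add[OF c S] by simp
  show "\<forall>\<^sub>F n in sequentially. (x (Suc n) - (1 / real (Suc n)) *\<^sub>R S (Suc n)) - (x n - (1 / real n) *\<^sub>R S n)
      = (c n + (1 / real n) *\<^sub>R S n) / real (Suc n)"
    using rec eventually_gt_at_top[of 0]
    by eventually_elim (subst averaged_noise_recursion[where c = c], simp_all)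
qed

text \<open>The functionals \<open>w1\<close> and \<open>w2\<close> are eigencoordinates in which
  \<open>f\<close> contracts at rates \<open>m < m'\<close>. The argument has three passes: a crude
  rate slightly worse than \<open>m\<close> for both coordinates, then a residual decaying faster
  than \<open>n powr (-m)\<close>, and finally an exact limit for the slow coordinate and faster
  decay for the other.\<close>

theorem stochastic_approximation_rate:
  fixes x S :: "nat \<Rightarrow> 'a :: real_normed_vector" and H f :: "'a \<Rightarrow> 'a" and w1 w2 :: "'a \<Rightarrow> real"
  assumes f: "bounded_linear f" and w: "bounded_linear w1" "bounded_linear w2"
    and dec: "\<And>v. v = w1 v *\<^sub>R e1 + w2 v *\<^sub>R e2"
    and eig: "\<And>v. w1 (f v) = - m * w1 v" "\<And>v. w2 (f v) = - m' * w2 v"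
    and m: "0 < m" "m < m'" "m < \<beta>" "\<beta> < 1"
    and H: "\<And>y. norm (H y - f (y - g)) \<le> C * (norm (y - g))\<^sup>2"
    and rec: "\<forall>\<^sub>F n in sequentially. x (Suc n) - x n = (1 / real (Suc n)) *\<^sub>R (H (x n) + S (Suc n) - S n)"
    and noise: "\<forall>\<^sub>F n in sequentially. norm (S n) \<le> K * real n powr (1 - \<beta>)"
    and lim: "x \<longlonglongrightarrow> g"
  shows "convergent (\<lambda>n. real n powr m *\<^sub>R (x n - g))"
proof -
  interpret f: bounded_linear f by fact
  interpret w1: bounded_linear w1 by fact
  interpret w2: bounded_linear w2 by fact
  define E where "E n = (1 / real n) *\<^sub>R S n" for n
  define Z where "Z n = x n - g - E n" for n
  \<comment> \<open>\<open>R\<close> is what the drift of \<open>Z\<close> contains beyond the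
    linear part: the quadratic remainder of \<open>H\<close> at \<open>x n\<close> together with
    \<open>f (E n) + E n\<close>.\<close>
  define R where "R n = H (x n) - f (Z n) + E n" for n
  define N where "N n = \<bar>w1 (Z n)\<bar> + \<bar>w2 (Z n)\<bar>" for n
  obtain F where F: "F > 0" "\<And>v. norm (f v) \<le> norm v * F"
    using f.pos_bounded by blast
  obtain W1 where W1: "W1 > 0" "\<And>v. norm (w1 v) \<le> norm v * W1"
    using w1.pos_bounded by blast
  obtain W2 where W2: "W2 > 0" "\<And>v. norm (w2 v) \<le> norm v * W2"
    using w2.pos_bounded by blast
  \<comment> \<open>The constants \<open>D\<close> here and \<open>W\<close> below make the norm
    equivalent to the sum of the absolute eigencoordinates.\<close>
  define D where "D = norm e1 + norm e2"
  have D: "norm v \<le> D * (\<bar>w1 v\<bar> + \<bar>w2 v\<bar>)" for v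
  proof -
    have "norm v \<le> norm (w1 v *\<^sub>R e1) + norm (w2 v *\<^sub>R e2)"
      by (subst dec[of v]) (rule norm_triangle_ineq)
    also have "\<dots> \<le> D * (\<bar>w1 v\<bar> + \<bar>w2 v\<bar>)"
      by (simp add: D_def algebra_simps)
    finally show ?thesis .
  qed
  have D0: "D \<ge> 0" by (simp add: D_def)
  have C0: "C * (norm y)\<^sup>2 \<le> \<bar>C\<bar> * (norm y)\<^sup>2" for y :: 'a
    by (intro mult_right_mono) auto

  have E_bd: "\<forall>\<^sub>F n in sequentially. norm (E n) \<le> K * real n powr (-\<beta>)"
    using noise eventually_gt_at_top[of 0]
  proof eventually_elim
    case (elim n)
    then have "norm (E n) \<le> K * real n powr (1 - \<beta>) / real n"
      by (simp add: E_def field_simps)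
    then show ?case using elim by (simp add: powr_diff powr_minus field_simps)
  qed
  have pow0: "(\<lambda>n. real n powr (-a)) \<longlonglongrightarrow> 0" if "a > 0" for a :: real
    using that by real_asymp
  have Z_rec: "\<forall>\<^sub>F n in sequentially. Z (Suc n) = Z n + (1 / real (Suc n)) *\<^sub>R (f (Z n) + R n)"
    using rec eventually_gt_at_top[of 0]
  proof eventually_elim
    case (elim n)
    have "Z (Suc n) - Z n = (1 / real (Suc n)) *\<^sub>R (H (x n) + E n)"
      using averaged_noise_recursion[of x n "\<lambda>n. H (x n)" S] elim by (simp add: Z_def E_def)
    also have "H (x n) + E n = f (Z n) + R n"
      by (simp add: R_def)
    finally show ?case by (simp add: algebra_simps)
  qed
  have w1_rec: "\<forall>\<^sub>F n in sequentially. w1 (Z (Suc n)) = (1 - m / real (Suc n)) * w1 (Z n) + w1 (R n) / real (Suc n)"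
    using Z_rec by eventually_elim (simp add: w1.add w1.scaleR eig algebra_simps add_divide_distrib)
  have w2_rec: "\<forall>\<^sub>F n in sequentially. w2 (Z (Suc n)) = (1 - m' / real (Suc n)) * w2 (Z n) + w2 (R n) / real (Suc n)"
    using Z_rec by eventually_elim (simp add: w2.add w2.scaleR eig algebra_simps add_divide_distrib)

  define W where "W = W1 + W2"
  have W: "norm (w1 v) \<le> W * norm v" "norm (w2 v) \<le> W * norm v" "\<bar>w1 v\<bar> + \<bar>w2 v\<bar> \<le> W * norm v" for v
  proof -
    have "W1 * norm v \<le> W * norm v" "W2 * norm v \<le> W * norm v"
      using W1 W2 by (auto simp: W_def intro!: mult_right_mono)
    with W1(2)[of v] W2(2)[of v] show "norm (w1 v) \<le> W * norm v" "norm (w2 v) \<le> W * norm v"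
      "\<bar>w1 v\<bar> + \<bar>w2 v\<bar> \<le> W * norm v"
      by (auto simp: W_def algebra_simps)
  qed
  have W0: "W > 0" using W1 W2 by (simp add: W_def)
  have R_bd: "norm (R n) \<le> (F + 1) * norm (E n) + \<bar>C\<bar> * (norm (x n - g))\<^sup>2" for n
  proof -
    have "R n = (H (x n) - f (x n - g)) + (f (E n) + E n)"
      by (simp add: R_def Z_def f.diff)
    also have "norm \<dots> \<le> norm (H (x n) - f (x n - g)) + (norm (f (E n)) + norm (E n))"
      by (meson add_left_mono norm_triangle_ineq order.trans)
    also have "\<dots> \<le> \<bar>C\<bar> * (norm (x n - g))\<^sup>2 + (norm (E n) * F + norm (E n))"
      using H[of "x n"] F(2)[of "E n"] C0[of "x n - g"] by linarith
    finally show ?thesis by (simp add: algebra_simps)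
  qed
  have x_bd: "norm (x n - g) \<le> D * N n + norm (E n)" for n
  proof -
    have "norm (x n - g) = norm (Z n + E n)" by (simp add: Z_def)
    also have "\<dots> \<le> norm (Z n) + norm (E n)" by (rule norm_triangle_ineq)
    finally show ?thesis using D[of "Z n"] by (simp add: N_def)
  qed

  \<comment> \<open>Any value strictly between \<open>m / 2\<close> and \<open>m\<close> serves:
    below \<open>m\<close> it is attainable by the crude pass, and \<open>2 * \<mu> > m\<close>
    makes squared errors negligible at the final scale.\<close>
  define \<mu> where "\<mu> = 3 / 4 * m"
  define \<gamma> where "\<gamma> = min \<beta> (2 * \<mu>)"
  have \<mu>: "0 < \<mu>" "\<mu> < m" "\<mu> < \<beta>" "\<mu> < 1" and \<gamma>: "m < \<gamma>" "\<gamma> \<le> \<beta>" "\<gamma> \<le> 2 * \<mu>" "\<gamma> < 1"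
    using m by (auto simp: \<mu>_def \<gamma>_def min_def)

  have "\<exists>L. \<forall>\<^sub>F n in sequentially. N n \<le> L * real n powr (-\<mu>)"
  proof (rule recursive_decay)
    \<comment> \<open>Since \<open>x n\<close> tends to \<open>g\<close>, one factor of the
      quadratic error is eventually below \<open>\<eta>\<close>, and the error acts as a small
      linear perturbation. This \<open>\<eta>\<close> costs at most \<open>(m - \<mu>) / 2\<close>
      of the rate \<open>m\<close>, leaving \<open>(m + \<mu>) / 2 > \<mu>\<close>.\<close>
    define \<eta> where "\<eta> = (m - \<mu>) / (2 * (W * D + 1))"
    have "W * D + 1 > 0" using W0 D0 by (intro add_nonneg_pos) auto
    then have \<eta>: "\<eta> > 0" "W * D * \<eta> \<le> (m - \<mu>) / 2"
      using \<mu> by (auto simp: \<eta>_def field_simps)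
    have "(\<lambda>n. \<bar>C\<bar> * norm (x n - g)) \<longlonglongrightarrow> \<bar>C\<bar> * norm (g - g)"
      using lim by (intro tendsto_intros)
    then have "\<forall>\<^sub>F n in sequentially. \<bar>C\<bar> * norm (x n - g) < \<eta>"
      using \<eta> by (intro order_tendstoD) auto
    \<comment> \<open>Beyond \<open>m'\<close> both contraction factors are nonnegative, so absolute
      values pass through them.\<close>
    moreover have "\<forall>\<^sub>F n in sequentially. real n > m'"
      using filterlim_real_sequentially by (rule eventually_compose_filterlim[OF eventually_gt_at_top])
    ultimately show "\<forall>\<^sub>F n in sequentially. N (Suc n) \<le> (1 - ((m + \<mu>) / 2) / real (Suc n)) * N n
        + (W * (F + 1 + \<eta>) * K) * real n powr (-\<beta>) / real (Suc n)"
      using w1_rec w2_rec E_bd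
    proof eventually_elim
      case (elim n)
      have q: "0 \<le> 1 - m' / real (Suc n)" "1 - m' / real (Suc n) \<le> 1 - m / real (Suc n)"
        using elim(2) m by (auto simp: divide_simps)
      have "N (Suc n) \<le> ((1 - m / real (Suc n)) * \<bar>w1 (Z n)\<bar> + \<bar>w1 (R n)\<bar> / real (Suc n))
           + ((1 - m' / real (Suc n)) * \<bar>w2 (Z n)\<bar> + \<bar>w2 (R n)\<bar> / real (Suc n))"
        unfolding N_def elim(3,4) using q
        by (intro add_mono order.trans[OF abs_triangle_ineq])
             (auto simp: abs_mult abs_of_nonneg[OF q(1)] abs_of_nonneg[OF order.trans[OF q]]
               simp del: of_nat_Suc)
      also have "\<dots> \<le> ((1 - m / real (Suc n)) * \<bar>w1 (Z n)\<bar> + \<bar>w1 (R n)\<bar> / real (Suc n))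
           + ((1 - m / real (Suc n)) * \<bar>w2 (Z n)\<bar> + \<bar>w2 (R n)\<bar> / real (Suc n))"
        using q by (intro add_mono mult_right_mono) auto
      also have "\<dots> = (1 - m / real (Suc n)) * N n + (\<bar>w1 (R n)\<bar> + \<bar>w2 (R n)\<bar>) / real (Suc n)"
        by (simp add: N_def algebra_simps add_divide_distrib)
      also have "\<dots> \<le> (1 - m / real (Suc n)) * N n + (W * norm (R n)) / real (Suc n)"
        using W(3)[of "R n"] by (intro add_mono divide_right_mono) auto
      also have "W * norm (R n) \<le> W * ((F + 1) * norm (E n) + \<eta> * (D * N n + norm (E n)))"
      proof (intro mult_left_mono order.trans[OF R_bd] add_mono order.refl)
        have "\<bar>C\<bar> * (norm (x n - g))\<^sup>2 = (\<bar>C\<bar> * norm (x n - g)) * norm (x n - g)"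
          by (simp add: power2_eq_square)
        also have "\<dots> \<le> \<eta> * (D * N n + norm (E n))"
          using elim(1) x_bd[of n] \<eta> by (intro mult_mono) auto
        finally show "\<bar>C\<bar> * (norm (x n - g))\<^sup>2 \<le> \<eta> * (D * N n + norm (E n))" .
      qed (use W0 F in auto)
      also have "\<dots> = (W * D * \<eta>) * N n + W * (F + 1 + \<eta>) * norm (E n)"
        by (simp add: algebra_simps)
      also have "\<dots> \<le> (m - \<mu>) / 2 * N n + W * (F + 1 + \<eta>) * (K * real n powr (-\<beta>))"
        using \<eta> W0 F elim(5) by (intro add_mono mult_right_mono mult_left_mono) (auto simp: N_def)
      finally have "N (Suc n) \<le> (1 - m / real (Suc n)) * N n
          + ((m - \<mu>) / 2 * N n + W * (F + 1 + \<eta>) * (K * real n powr (-\<beta>))) / real (Suc n)"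
        by (simp add: divide_right_mono)
      also have "\<dots> = (1 - ((m + \<mu>) / 2) / real (Suc n)) * N n
        + (W * (F + 1 + \<eta>) * K) * real n powr (-\<beta>) / real (Suc n)"
        by (simp add: field_simps)
      finally show ?case .
    qed
  qed (use \<mu> in \<open>auto simp: N_def\<close>)
  then obtain L where L: "\<forall>\<^sub>F n in sequentially. N n \<le> L * real n powr (-\<mu>)" by blast

  \<comment> \<open>Second pass: by the crude rate the quadratic error is of order
    \<open>n powr (-(2 * \<mu>))\<close> and the noise part of order
    \<open>n powr (-\<beta>)\<close>; \<open>\<gamma>\<close> is the smaller exponent and still
    exceeds \<open>m\<close>.\<close>
  obtain B where R: "\<forall>\<^sub>F n in sequentially. norm (R n) \<le> B * real n powr (-\<gamma>)"
  proof
    show "\<forall>\<^sub>F n in sequentially. norm (R n) \<le> ((F + 1) * \<bar>K\<bar> + \<bar>C\<bar> * (D * \<bar>L\<bar> + \<bar>K\<bar>)\<^sup>2) * real n powr (-\<gamma>)"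
      using L E_bd eventually_gt_at_top[of 0]
    proof eventually_elim
      case (elim n)
      have n1: "real n \<ge> 1" using elim by simp
      have EK: "norm (E n) \<le> \<bar>K\<bar> * real n powr (-\<beta>)"
        using elim(2) mult_right_mono[of K "\<bar>K\<bar>" "real n powr -\<beta>"] by (meson abs_ge_self order.trans powr_ge_zero)
      have NL: "N n \<le> \<bar>L\<bar> * real n powr (-\<mu>)"
        using elim(1) mult_right_mono[of L "\<bar>L\<bar>" "real n powr -\<mu>"] by (meson abs_ge_self order.trans powr_ge_zero)
      have "norm (x n - g) \<le> D * (\<bar>L\<bar> * real n powr (-\<mu>)) + \<bar>K\<bar> * real n powr (-\<mu>)"
        using \<mu> n1 by (intro order.trans[OF x_bd] add_mono mult_left_mono NL order.trans[OF EK] powr_mono D0) auto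
      also have "\<dots> = (D * \<bar>L\<bar> + \<bar>K\<bar>) * real n powr (-\<mu>)" by (simp add: algebra_simps)
      finally have "(norm (x n - g))\<^sup>2 \<le> ((D * \<bar>L\<bar> + \<bar>K\<bar>) * real n powr (-\<mu>))\<^sup>2"
        by (intro power_mono) auto
      also have "\<dots> = (D * \<bar>L\<bar> + \<bar>K\<bar>)\<^sup>2 * real n powr (-(2 * \<mu>))"
        by (simp add: power_mult_distrib power2_eq_square flip: powr_add)
      also have "\<dots> \<le> (D * \<bar>L\<bar> + \<bar>K\<bar>)\<^sup>2 * real n powr (-\<gamma>)"
        using \<gamma> n1 by (intro mult_left_mono powr_mono) auto
      finally have xq: "(norm (x n - g))\<^sup>2 \<le> (D * \<bar>L\<bar> + \<bar>K\<bar>)\<^sup>2 * real n powr (-\<gamma>)" .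
      have "norm (E n) \<le> \<bar>K\<bar> * real n powr (-\<gamma>)"
        using \<gamma> n1 by (intro order.trans[OF EK] mult_left_mono powr_mono) auto
      then have "norm (R n) \<le> (F + 1) * (\<bar>K\<bar> * real n powr (-\<gamma>))
          + \<bar>C\<bar> * ((D * \<bar>L\<bar> + \<bar>K\<bar>)\<^sup>2 * real n powr (-\<gamma>))"
        using xq F by (intro order.trans[OF R_bd] add_mono mult_left_mono) auto
      then show ?case by (simp add: algebra_simps)
    qed
  qed
  have wR: "\<forall>\<^sub>F n in sequentially. \<bar>w1 (R n)\<bar> \<le> (W * B) * real n powr (-\<gamma>)"
    "\<forall>\<^sub>F n in sequentially. \<bar>w2 (R n)\<bar> \<le> (W * B) * real n powr (-\<gamma>)"
  proof -
    have *: "W * norm v \<le> (W * B) * t" if "norm v \<le> B * t" for v :: 'a and t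
      using mult_left_mono[OF that, of W] W0 by (simp add: mult_ac)
    show "\<forall>\<^sub>F n in sequentially. \<bar>w1 (R n)\<bar> \<le> (W * B) * real n powr (-\<gamma>)"
      using R by eventually_elim (use W * in \<open>fastforce intro: order.trans\<close>)
    show "\<forall>\<^sub>F n in sequentially. \<bar>w2 (R n)\<bar> \<le> (W * B) * real n powr (-\<gamma>)"
      using R by eventually_elim (use W * in \<open>fastforce intro: order.trans\<close>)
  qed

  have "\<forall>\<^sub>F n in sequentially. \<bar>w1 (Z n)\<bar> \<le> \<bar>L\<bar>"
    using L eventually_gt_at_top[of 0]
  proof eventually_elim
    case (elim n)
    have "\<bar>w1 (Z n)\<bar> \<le> L * real n powr (-\<mu>)" using elim(1) by (simp add: N_def)
    also have "\<dots> \<le> \<bar>L\<bar> * real n powr 0"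
      using elim \<mu> by (intro mult_mono powr_mono) auto
    finally show ?case using elim by simp
  qed
  then have c1: "convergent (\<lambda>n. real n powr m * w1 (Z n))"
    using m \<gamma> by (intro recursive_limit[OF w1_rec wR(1)]) auto

  \<comment> \<open>Third pass for the fast coordinate: a rate strictly between \<open>m\<close> and
    \<open>min m' \<gamma>\<close> makes it vanish after scaling by \<open>n powr m\<close>.\<close>
  obtain \<mu>2 where \<mu>2: "m < \<mu>2" "\<mu>2 < m'" "\<mu>2 < \<gamma>"
    using dense[of m "min m' \<gamma>"] m \<gamma> by auto
  have "\<exists>L. \<forall>\<^sub>F n in sequentially. \<bar>w2 (Z n)\<bar> \<le> L * real n powr (-\<mu>2)"
  proof (rule recursive_decay)
    have "\<forall>\<^sub>F n in sequentially. real n > m'"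
      using filterlim_real_sequentially by (rule eventually_compose_filterlim[OF eventually_gt_at_top])
    then show "\<forall>\<^sub>F n in sequentially. \<bar>w2 (Z (Suc n))\<bar> \<le> (1 - m' / real (Suc n)) * \<bar>w2 (Z n)\<bar>
        + (W * B) * real n powr (-\<gamma>) / real (Suc n)"
      using w2_rec wR(2)
    proof eventually_elim
      case (elim n)
      have "0 \<le> 1 - m' / real (Suc n)" using elim(1) by (auto simp: divide_simps)
      then have "\<bar>w2 (Z (Suc n))\<bar> \<le> (1 - m' / real (Suc n)) * \<bar>w2 (Z n)\<bar> + \<bar>w2 (R n)\<bar> / real (Suc n)"
        unfolding elim(2) by (intro order.trans[OF abs_triangle_ineq]) (auto simp: abs_mult)
      then show ?case using elim(3) divide_right_mono[OF elim(3), of "real (Suc n)"] by linarith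
    qed
  qed (use \<mu>2 m \<gamma> in auto)
  then obtain L2 where L2: "\<forall>\<^sub>F n in sequentially. \<bar>w2 (Z n)\<bar> \<le> L2 * real n powr (-\<mu>2)" by blast

  have decay: "(\<lambda>n. real n powr m *\<^sub>R v n) \<longlonglongrightarrow> 0"
    if "\<forall>\<^sub>F n in sequentially. norm (v n) \<le> B * real n powr (-b)" "m < b"
    for v :: "nat \<Rightarrow> 'b :: real_normed_vector" and B b
  proof (rule tendsto_norm_zero_cancel, rule tendsto_0_le[where K = 1])
    show "(\<lambda>n. B * real n powr (-(b - m))) \<longlonglongrightarrow> 0"
      using tendsto_mult_left[OF pow0[of "b - m"], of B] that(2) by simp
    show "\<forall>\<^sub>F n in sequentially. norm (norm (real n powr m *\<^sub>R v n)) \<le> norm (B * real n powr (-(b - m))) * 1"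
      using that(1)
    proof eventually_elim
      case (elim n)
      have "real n powr m * norm (v n) \<le> real n powr m * (B * real n powr (-b))"
        using elim by (intro mult_left_mono) auto
      also have "\<dots> = B * real n powr (-(b - m))"
        by (simp add: mult.left_commute flip: powr_add)
      finally show ?case by (auto intro: order.trans[OF _ abs_ge_self])
    qed
  qed
  from c1 obtain l where l: "(\<lambda>n. real n powr m * w1 (Z n)) \<longlonglongrightarrow> l"
    by (auto simp: convergent_def)
  have "(\<lambda>n. real n powr m *\<^sub>R w2 (Z n)) \<longlonglongrightarrow> 0"
    using L2 \<mu>2 by (intro decay[of _ L2 \<mu>2]) auto
  moreover have "(\<lambda>n. real n powr m *\<^sub>R E n) \<longlonglongrightarrow> 0"
    using E_bd m by (intro decay[of _ K \<beta>]) auto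
  \<comment> \<open>Only the slow direction \<open>e1\<close> survives in the limit.\<close>
  ultimately have "(\<lambda>n. (real n powr m * w1 (Z n)) *\<^sub>R e1 + (real n powr m *\<^sub>R w2 (Z n)) *\<^sub>R e2 + real n powr m *\<^sub>R E n)
      \<longlonglongrightarrow> l *\<^sub>R e1 + 0 *\<^sub>R e2 + 0"
    using l by (intro tendsto_intros)
  moreover have "(real n powr m * w1 (Z n)) *\<^sub>R e1 + (real n powr m *\<^sub>R w2 (Z n)) *\<^sub>R e2 + real n powr m *\<^sub>R E n
      = real n powr m *\<^sub>R (x n - g)" for n
  proof -
    have "real n powr m *\<^sub>R (x n - g) = real n powr m *\<^sub>R (Z n + E n)" by (simp add: Z_def)
    also have "Z n = w1 (Z n) *\<^sub>R e1 + w2 (Z n) *\<^sub>R e2" by (rule dec)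
    finally show ?thesis by (simp add: scaleR_add_right mult_ac)
  qed
  ultimately show ?thesis by (auto simp: convergent_def)
qed

section \<open>Growth of bounded martingales\<close>

context prob_space
begin

lemma AE_in_finite_set:
  fixes Z :: "'a \<Rightarrow> real"
  assumes Z: "Z \<in> borel_measurable M" and A: "finite A"
    and sum: "(\<Sum>a\<in>A. prob {\<omega>\<in>space M. Z \<omega> = a}) = 1"
  shows "AE \<omega> in M. Z \<omega> \<in> A"
proof -
  note Z [measurable]
  have "prob (\<Union>a\<in>A. {\<omega>\<in>space M. Z \<omega> = a}) = 1"
    unfolding sum [symmetric] using A
    by (intro finite_measure_finite_Union) (auto simp: disjoint_family_on_def)
  also have "(\<Union>a\<in>A. {\<omega>\<in>space M. Z \<omega> = a}) = {\<omega>\<in>space M. Z \<omega> \<in> A}" by auto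
  finally show ?thesis by (rule AE_prob_1[THEN AE_mp]) auto
qed

text \<open>The Azuma--Hoeffding argument with \<open>t = 1 / sqrt n\<close>; the martingale property enters only
  through the vanishing of \<open>E (exp (t S n) \<xi> n)\<close>.\<close>

lemma martingale_exp_moment:
  fixes \<xi> :: "nat \<Rightarrow> 'a \<Rightarrow> real"
  assumes meas: "\<And>n. \<xi> n \<in> borel_measurable M"
    and bd: "\<And>n \<omega>. \<bar>\<xi> n \<omega>\<bar> \<le> 1"
    and mart: "\<And>n t. expectation (\<lambda>\<omega>. exp (t * (\<Sum>k<n. \<xi> k \<omega>)) * \<xi> n \<omega>) = 0"
    and t: "\<bar>t\<bar> \<le> 1"
  shows "expectation (\<lambda>\<omega>. exp (t * (\<Sum>k<n. \<xi> k \<omega>))) \<le> exp (real n * t\<^sup>2)"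
proof (induction n)
  case 0
  then show ?case by (simp add: prob_space)
next
  case (Suc n)
  note meas [measurable]
  let ?e = "\<lambda>n \<omega>. exp (t * (\<Sum>k<n. \<xi> k \<omega>))"
  \<comment> \<open>A deterministic bound on the partial sums settles all integrability
    questions.\<close>
  have e_le: "?e n \<omega> \<le> exp (real n)" for n \<omega>
  proof -
    have "\<bar>\<Sum>k<n. \<xi> k \<omega>\<bar> \<le> (\<Sum>k<n. 1)"
      by (intro order.trans[OF sum_abs] sum_mono bd)
    then have "\<bar>t\<bar> * \<bar>\<Sum>k<n. \<xi> k \<omega>\<bar> \<le> 1 * real n"
      using t by (intro mult_mono) auto
    then have "t * (\<Sum>k<n. \<xi> k \<omega>) \<le> real n"
      by (simp add: abs_mult[symmetric])
    then show ?thesis by simp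
  qed
  have int: "integrable M (?e n)" for n
    using e_le by (intro integrable_const_bound[where B = "exp (real n)"]) auto
  have int': "integrable M (\<lambda>\<omega>. ?e n \<omega> * \<xi> n \<omega>)" for n
    by (rule Bochner_Integration.integrable_bound[OF int[of n]])
       (use bd in \<open>auto simp: abs_mult intro!: mult_left_le\<close>)
  have "expectation (?e (Suc n)) \<le> expectation (\<lambda>\<omega>. (1 + t\<^sup>2) * ?e n \<omega> + t * (?e n \<omega> * \<xi> n \<omega>))"
  proof (intro integral_mono)
    fix \<omega>
    have "\<bar>t * \<xi> n \<omega>\<bar> \<le> 1" using t bd[of n \<omega>] by (simp add: abs_mult mult_le_one)
    then have "exp (t * \<xi> n \<omega>) \<le> 1 + t * \<xi> n \<omega> + (t * \<xi> n \<omega>)\<^sup>2" by (rule exp_le_quadratic)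
    also have "(t * \<xi> n \<omega>)\<^sup>2 \<le> t\<^sup>2 * 1"
      unfolding power_mult_distrib using bd[of n \<omega>] by (intro mult_left_mono) (auto simp: abs_square_le_1)
    finally have "?e n \<omega> * exp (t * \<xi> n \<omega>) \<le> ?e n \<omega> * (1 + t * \<xi> n \<omega> + t\<^sup>2)"
      by (intro mult_left_mono) auto
    then show "?e (Suc n) \<omega> \<le> (1 + t\<^sup>2) * ?e n \<omega> + t * (?e n \<omega> * \<xi> n \<omega>)"
      by (simp add: algebra_simps exp_add)
  qed (use int[of "Suc n"] int[of n] int'[of n] in auto)
  also have "\<dots> = (1 + t\<^sup>2) * expectation (?e n)"
    using int[of n] int'[of n] mart[of t n] by simp
  also have "\<dots> \<le> exp (t\<^sup>2) * exp (real n * t\<^sup>2)"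
    using Suc exp_ge_add_one_self[of "t\<^sup>2"] by (intro mult_mono) (auto intro: Bochner_Integration.integral_nonneg)
  finally show ?case by (simp add: algebra_simps flip: exp_add)
qed

text \<open>With \<open>\<bar>t\<bar> = 1 / sqrt n\<close> the exponential moment is at most
  \<open>exp 1\<close>. Markov's inequality then bounds the probability of exceeding
  \<open>n powr (1/2 + \<delta>)\<close> by \<open>exp 1 * exp (- (n powr \<delta>))\<close>, which
  is summable, and Borel--Cantelli applies. The sign \<open>\<sigma>\<close> covers both
  tails.\<close>

lemma martingale_growth:
  fixes \<xi> :: "nat \<Rightarrow> 'a \<Rightarrow> real"
  assumes meas: "\<And>n. \<xi> n \<in> borel_measurable M"
    and bd: "\<And>n \<omega>. \<bar>\<xi> n \<omega>\<bar> \<le> 1"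
    and mart: "\<And>n t. expectation (\<lambda>\<omega>. exp (t * (\<Sum>k<n. \<xi> k \<omega>)) * \<xi> n \<omega>) = 0"
    and \<delta>: "0 < \<delta>"
  shows "AE \<omega> in M. \<forall>\<^sub>F n in sequentially. \<bar>\<Sum>k<n. \<xi> k \<omega>\<bar> \<le> real n powr (1/2 + \<delta>)"
proof -
  note meas [measurable]
  have one_sided: "AE \<omega> in M. \<forall>\<^sub>F n in sequentially. \<sigma> * (\<Sum>k<n. \<xi> k \<omega>) \<le> real n powr (1/2 + \<delta>)"
    if \<sigma>: "\<sigma> \<in> {1, -1}" for \<sigma> :: real
  proof -
    define A where "A n = {\<omega>\<in>space M. exp (\<sigma> / sqrt (real n) * (\<Sum>k<n. \<xi> k \<omega>)) \<ge> exp (real n powr \<delta>)}" for n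
    have A_bd: "prob (A n) \<le> exp 1 * exp (- (real n powr \<delta>))" if "n > 0" for n
    proof -
      have t: "\<bar>\<sigma> / sqrt (real n)\<bar> \<le> 1" "(\<sigma> / sqrt (real n))\<^sup>2 = 1 / real n"
        using \<sigma> that by (auto simp: power_divide)
      have bd': "exp (\<sigma> / sqrt (real n) * (\<Sum>k<n. \<xi> k \<omega>)) \<le> exp (real n)" for \<omega>
      proof -
        have "\<bar>\<Sum>k<n. \<xi> k \<omega>\<bar> \<le> (\<Sum>k<n. 1)"
          by (intro order.trans[OF sum_abs] sum_mono bd)
        then have "\<bar>\<sigma> / sqrt (real n)\<bar> * \<bar>\<Sum>k<n. \<xi> k \<omega>\<bar> \<le> 1 * real n"
          using t by (intro mult_mono) auto
        then show ?thesis unfolding abs_mult[symmetric] exp_le_cancel_iff by linarith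
      qed
      have "prob (A n) \<le> expectation (\<lambda>\<omega>. exp (\<sigma> / sqrt (real n) * (\<Sum>k<n. \<xi> k \<omega>))) / exp (real n powr \<delta>)"
        unfolding A_def
        by (rule integral_Markov_inequality_measure[where A = "space M"])
           (use bd' in \<open>auto intro!: integrable_const_bound[where B = "exp (real n)"]\<close>)
      also have "\<dots> \<le> exp (real n * (\<sigma> / sqrt (real n))\<^sup>2) / exp (real n powr \<delta>)"
        by (intro divide_right_mono martingale_exp_moment meas bd mart t) auto
      finally show ?thesis using that unfolding t by (simp add: exp_minus field_simps)
    qed
    have "(\<lambda>n. exp 1 * exp (- (real n powr \<delta>))) \<in> O(\<lambda>n. real n powr (-2))"
      using \<delta> by real_asymp
    moreover have "summable (\<lambda>n. norm (real n powr (-2)))"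
      by (simp, subst summable_real_powr_iff, simp)
    ultimately have "summable (\<lambda>n. exp 1 * exp (- (real n powr \<delta>)))"
      by (rule summable_comparison_test_bigo[rotated])
    moreover have "\<forall>\<^sub>F n in sequentially. norm (prob (A n)) \<le> exp 1 * exp (- (real n powr \<delta>))"
      using eventually_gt_at_top[of 0] by eventually_elim (use A_bd in auto)
    ultimately have "summable (\<lambda>n. prob (A n))"
      by (rule summable_comparison_test_ev[rotated])
    then have "AE \<omega> in M. \<forall>\<^sub>F n in sequentially. \<omega> \<in> space M - A n"
      by (intro borel_cantelli_AE1) (auto simp: A_def less_top[symmetric])
    then show ?thesis
    proof eventually_elim
      case (elim \<omega>)
      then show ?case using eventually_gt_at_top[of 0]
      proof eventually_elim
        case (elim n)
        then have "\<sigma> / sqrt (real n) * (\<Sum>k<n. \<xi> k \<omega>) \<le> real n powr \<delta>"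
          by (auto simp: A_def)
        then have "sqrt (real n) * (\<sigma> / sqrt (real n) * (\<Sum>k<n. \<xi> k \<omega>)) \<le> sqrt (real n) * real n powr \<delta>"
          by (intro mult_left_mono) auto
        also have "\<dots> = real n powr (1/2 + \<delta>)"
          by (simp add: powr_add powr_half_sqrt)
        finally show ?case using elim by simp
      qed
    qed
  qed
  have "AE \<omega> in M. \<forall>\<^sub>F n in sequentially. 1 * (\<Sum>k<n. \<xi> k \<omega>) \<le> real n powr (1/2 + \<delta>)"
       "AE \<omega> in M. \<forall>\<^sub>F n in sequentially. (-1) * (\<Sum>k<n. \<xi> k \<omega>) \<le> real n powr (1/2 + \<delta>)"
    by (intro one_sided; simp)+
  then show ?thesis
  proof eventually_elim
    case (elim \<omega>)
    from elim show ?case by eventually_elim linarith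
  qed
qed

end

section \<open>The walk and its noise\<close>

text \<open>\<open>X\<close> itself need not be measurable: on the null set where some \<open>U\<close> leaves its range it may refer
  to the arbitrary function \<open>X 0\<close>. Here the corresponding sum is \<open>0\<close> instead.\<close>

fun walk :: "(lbl \<Rightarrow> real) \<Rightarrow> nat \<Rightarrow> real" where
  "walk v n = (if n \<le> 2 then (if n = 0 then 0 else v (LX n)) else
     clip (v (LA1 n) * (\<Sum>i\<in>{1..<n}. of_bool (v (LU1 n) = real i) * walk v i) +
           v (LA2 n) * (\<Sum>i\<in>{1..<n}. of_bool (v (LU2 n) = real i) * walk v i)))"

declare walk.simps [simp del]

definition block :: "nat \<Rightarrow> lbl set" where
  "block m = {LU1 m, LU2 m, LA1 m, LA2 m}"

definition past :: "nat \<Rightarrow> lbl set" where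
  "past n = {LX 1, LX 2} \<union> (\<Union>m\<in>{3..n}. block m)"

lemma past_subset: "past n \<subseteq> prim_index"
  by (auto simp: past_def prim_index_def block_def)

lemma block_subset: "3 \<le> m \<Longrightarrow> block m \<subseteq> prim_index"
  by (auto simp: prim_index_def block_def)

lemma past_Int_block: "past n \<inter> block (Suc n) = {}"
  by (auto simp: past_def block_def)

text \<open>Adaptedness in deterministic form: by recursion, every label read up to time
  \<open>n\<close> lies in \<open>past n\<close>. This is what lets the path be written as a
  function of the history.\<close>

lemma walk_cong:
  assumes "\<And>i. i \<in> past n \<Longrightarrow> v i = v' i" "k \<le> n"
  shows "walk v k = walk v' k"
  using assms(2)
proof (induction k rule: less_induct)
  case (less k)
  show ?case
  proof (cases "k \<le> 2")
    case True
    then have "k = 0 \<or> k = 1 \<or> k = 2" by auto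
    then show ?thesis using assms(1) by (subst (1 2) walk.simps) (auto simp: past_def)
  next
    case False
    then have "block k \<subseteq> past n" using less.prems by (force simp: past_def)
    then have "v i = v' i" if "i \<in> block k" for i using assms(1) that by auto
    then have "v (LU1 k) = v' (LU1 k)" "v (LU2 k) = v' (LU2 k)" "v (LA1 k) = v' (LA1 k)" "v (LA2 k) = v' (LA2 k)"
      by (auto simp: block_def)
    moreover have "(\<Sum>i\<in>{1..<k}. of_bool (u = real i) * walk v i) = (\<Sum>i\<in>{1..<k}. of_bool (u = real i) * walk v' i)" for u
      using less by (intro sum.cong) auto
    ultimately show ?thesis
      by (subst (1 2) walk.simps) (simp only: False if_False)
  qed
qed

lemma clip_measurable [measurable]: "clip \<in> borel_measurable borel"
  unfolding clip_def by measurable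

lemma walk_measurable:
  assumes "k \<le> n"
  shows "(\<lambda>v. walk v k) \<in> borel_measurable (PiM (past n) (\<lambda>_. borel))"
  using assms
proof (induction k rule: less_induct)
  case (less k)
  show ?case
  proof (cases "k \<le> 2")
    case True
    then have "k = 0 \<or> k = 1 \<or> k = 2" by auto
    moreover have "LX 1 \<in> past n" "LX 2 \<in> past n" by (auto simp: past_def)
    ultimately show ?thesis by (subst walk.simps) auto
  next
    case False
    then have *: "block k \<subseteq> past n" using less.prems by (force simp: past_def)
    have [measurable]: "(\<lambda>v. walk v i) \<in> borel_measurable (PiM (past n) (\<lambda>_. borel))" if "i \<in> {1..<k}" for i
      using less that by auto
    have [measurable]: "(\<lambda>v. v l) \<in> borel_measurable (PiM (past n) (\<lambda>_. borel))" if "l \<in> block k" for l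
      using * that by auto
    have [measurable]: "LA1 k \<in> block k" "LA2 k \<in> block k" "LU1 k \<in> block k" "LU2 k \<in> block k"
      by (auto simp: block_def)
    show ?thesis by (subst walk.simps) (simp only: False if_False, measurable)
  qed
qed

section \<open>Law of a single step given the past\<close>

lemma clip_trinary: "a \<in> {-1, 0, 1} \<Longrightarrow> b \<in> {-1, 0, 1} \<Longrightarrow> clip (a + b) \<in> {-1, 0, 1}"
  by (auto simp: clip_def)

text \<open>The clipped sum is \<open>s\<close> in three mutually exclusive cases, each a product of
  conditions on one channel; this makes the two channels separable despite the clipping.\<close>

lemma clip_sum_eq_iff:
  assumes "a \<in> {-1, 0, 1}" "b \<in> {-1, 0, 1}" "s \<in> {-1, 1}"
  shows "(of_bool (clip (a + b) = s) :: real) = of_bool (a = s) * of_bool (b = s)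
    + of_bool (a = s) * of_bool (b = 0) + of_bool (a = 0) * of_bool (b = s)"
  using assms by (auto simp: clip_def)

text \<open>The levels \<open>1\<close> and \<open>-1\<close> are the two coordinates of
  \<open>Gamma_n\<close>; the level \<open>0\<close> is the proportion of zero steps.\<close>

definition level :: "(nat \<Rightarrow> real) \<Rightarrow> real \<Rightarrow> nat \<Rightarrow> real" where
  "level y s n = real (card {k\<in>{1..n}. y k = s}) / real n"

lemma level_eq_sum: "level y s n = (\<Sum>k\<in>{1..n}. of_bool (y k = s)) / real n"
  by (simp add: level_def of_bool_def sum.If_cases Int_def)

lemma level_nonneg: "0 \<le> level y s n"
  by (simp add: level_def)

lemma level_add_le_1:
  assumes "s \<noteq> t"
  shows "level y s n + level y t n \<le> 1"
proof -
  have "(\<Sum>k\<in>{1..n}. (of_bool (y k = s) :: real)) + (\<Sum>k\<in>{1..n}. of_bool (y k = t)) \<le> (\<Sum>k\<in>{1..n}. 1)"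
    unfolding sum.distrib [symmetric] using assms by (intro sum_mono) auto
  then show ?thesis
    unfolding level_eq_sum add_divide_distrib [symmetric] by (intro divide_le_eq_1[THEN iffD2]) auto
qed

lemma level_zero:
  assumes "\<And>k. k \<in> {1..n} \<Longrightarrow> y k \<in> {-1, 0, 1}" "n > 0" "s \<in> {-1, 1}"
  shows "level y 0 n = 1 - level y s n - level y (-s) n"
proof -
  have "(\<Sum>k\<in>{1..n}. (of_bool (y k = 0) :: real)) = (\<Sum>k\<in>{1..n}. 1 - of_bool (y k = s) - of_bool (y k = -s))"
    using assms by (intro sum.cong) force+
  then show ?thesis using assms(2)
    by (simp only: level_eq_sum sum_subtractf) (simp add: diff_divide_distrib del: sum_of_bool_eq)
qed

text \<open>The conditional probability that step \<open>Suc n\<close> equals \<open>s\<close>: the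
  probability that neither channel delivers \<open>-s\<close>, minus the probability that both
  deliver \<open>0\<close>. Subtracting \<open>level y s n\<close> gives a coordinate of
  \<open>h\<close>.\<close>

definition step_prob :: "real \<Rightarrow> (nat \<Rightarrow> real) \<Rightarrow> real \<Rightarrow> nat \<Rightarrow> real" where
  "step_prob p y s n = (1 - (1 - p) * level y s n - p * level y (-s) n)\<^sup>2 - (1 - level y s n - level y (-s) n)\<^sup>2"

text \<open>Since the weights factorise, the double sum over the two memory channels is a product of
  single-channel sums.\<close>

lemma step_prob_eq_sum:
  fixes p :: real
  defines "w \<equiv> \<lambda>a :: real. if a = 1 then p else 1 - p"
  assumes y: "\<And>k. k \<in> {1..n} \<Longrightarrow> y k \<in> {-1, 0, 1}" and n: "n > 0" and s: "s \<in> {-1, 1}"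
  shows "(\<Sum>((i, a), (j, b))\<in>({1..n} \<times> {1, -1}) \<times> ({1..n} \<times> {1, -1}).
            w a * w b / (real n)\<^sup>2 * of_bool (clip (a * y i + b * y j) = s)) = step_prob p y s n"
proof -
  let ?T = "{1..n} \<times> {1, -1 :: real}"
  \<comment> \<open>The probability that one memory channel delivers the value
    \<open>t\<close>.\<close>
  define E where "E t = (\<Sum>(i, a)\<in>?T. w a * of_bool (a * y i = t)) / real n" for t
  have E: "E t = p * level y t n + (1 - p) * level y (-t) n" for t
  proof -
    have "(\<Sum>(i, a)\<in>?T. w a * of_bool (a * y i = t)) =
       (\<Sum>i\<in>{1..n}. p * of_bool (y i = t) + (1 - p) * of_bool (y i = -t))"
      unfolding sum.cartesian_product [symmetric]
      by (intro sum.cong) (auto simp: w_def minus_equation_iff)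
    also have "\<dots> = p * (\<Sum>i\<in>{1..n}. of_bool (y i = t)) + (1 - p) * (\<Sum>i\<in>{1..n}. of_bool (y i = -t))"
      by (simp only: sum.distrib sum_distrib_left)
    finally show ?thesis by (simp only: E_def level_eq_sum add_divide_distrib times_divide_eq_right)
  qed
  have prod: "(\<Sum>((i, a), (j, b))\<in>?T \<times> ?T. w a * w b / (real n)\<^sup>2 * (of_bool (a * y i = t) * of_bool (b * y j = u)))
     = E t * E u" for t u
    unfolding E_def times_divide_times_eq sum_product sum.cartesian_product sum_divide_distrib
    by (intro sum.cong) (auto simp: power2_eq_square)
  have "(\<Sum>((i, a), (j, b))\<in>?T \<times> ?T. w a * w b / (real n)\<^sup>2 * of_bool (clip (a * y i + b * y j) = s)) =
    (\<Sum>((i, a), (j, b))\<in>?T \<times> ?T. w a * w b / (real n)\<^sup>2 * (of_bool (a * y i = s) * of_bool (b * y j = s))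
      + w a * w b / (real n)\<^sup>2 * (of_bool (a * y i = s) * of_bool (b * y j = 0))
      + w a * w b / (real n)\<^sup>2 * (of_bool (a * y i = 0) * of_bool (b * y j = s)))"
  proof (intro sum.cong refl, clarify)
    fix i j and a b :: real assume "i \<in> {1..n}" "j \<in> {1..n}" "a \<in> {1, -1}" "b \<in> {1, -1}"
    then have "a * y i \<in> {-1, 0, 1}" "b * y j \<in> {-1, 0, 1}" using y by force+
    from clip_sum_eq_iff[OF this s]
    show "w a * w b / (real n)\<^sup>2 * of_bool (clip (a * y i + b * y j) = s) =
      w a * w b / (real n)\<^sup>2 * (of_bool (a * y i = s) * of_bool (b * y j = s))
      + w a * w b / (real n)\<^sup>2 * (of_bool (a * y i = s) * of_bool (b * y j = 0))
      + w a * w b / (real n)\<^sup>2 * (of_bool (a * y i = 0) * of_bool (b * y j = s))"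
      by (simp only: ring_distribs)
  qed
  also have "\<dots> = E s * E s + E s * E 0 + E 0 * E s"
    unfolding prod [symmetric] sum.distrib [symmetric] by (simp add: case_prod_unfold)
  also have "\<dots> = step_prob p y s n"
  proof -
    have E0: "E 0 = 1 - level y s n - level y (-s) n"
      using level_zero[of n y s, OF y n s] E[of 0] by (simp add: algebra_simps)
    show ?thesis
      unfolding step_prob_def E0 E[of s] by (simp add: algebra_simps power2_eq_square)
  qed
  finally show ?thesis .
qed

text \<open>A difference of squares of two ordered numbers in the unit interval. It holds for every
  sequence \<open>y\<close>, so the noise is bounded everywhere and not merely almost
  surely.\<close>

lemma step_prob_bounds:
  assumes p: "0 \<le> p" "p \<le> 1" and s: "s \<noteq> 0"
  shows "step_prob p y s n \<in> {0..1}"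
proof -
  let ?a = "level y s n" and ?b = "level y (-s) n"
  have ab: "0 \<le> ?a" "0 \<le> ?b" "?a + ?b \<le> 1"
    using s level_add_le_1[of s "-s" y n] by (auto simp: level_nonneg)
  have "0 \<le> (1 - p) * ?a" "0 \<le> p * ?b" "0 \<le> p * ?a" "0 \<le> (1 - p) * ?b"
    using ab p by auto
  then have le: "1 - ?a - ?b \<le> 1 - (1 - p) * ?a - p * ?b" "1 - (1 - p) * ?a - p * ?b \<le> 1"
    by (auto simp: algebra_simps)
  then have "(1 - ?a - ?b)\<^sup>2 \<le> (1 - (1 - p) * ?a - p * ?b)\<^sup>2" "(1 - (1 - p) * ?a - p * ?b)\<^sup>2 \<le> 1\<^sup>2"
    using ab by (intro power_mono; linarith)+
  then show ?thesis unfolding step_prob_def atLeastAtMost_iff power_one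
    using zero_le_power2[of "1 - ?a - ?b"] by (intro conjI; linarith)
qed

section \<open>The walk as a function of independent primitive variables\<close>

locale memory_walk = prob_space M for M :: "'a measure" +
  fixes V :: "lbl \<Rightarrow> 'a \<Rightarrow> real" and p :: real
  assumes indep: "indep_vars (\<lambda>_. borel) V prim_index"
    and p: "0 < p" "p < 1"
    and start: "k \<in> {1, 2} \<Longrightarrow> prob {\<omega>\<in>space M. V (LX k) \<omega> = 1} = 1/2 \<and> prob {\<omega>\<in>space M. V (LX k) \<omega> = -1} = 1/2"
    and memory: "2 \<le> n \<Longrightarrow> k \<in> {1..n} \<Longrightarrow>
      prob {\<omega>\<in>space M. V (LU1 (Suc n)) \<omega> = real k} = 1 / real n \<and>
      prob {\<omega>\<in>space M. V (LU2 (Suc n)) \<omega> = real k} = 1 / real n"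
    and sign: "2 \<le> n \<Longrightarrow>
      prob {\<omega>\<in>space M. V (LA1 (Suc n)) \<omega> = 1} = p \<and> prob {\<omega>\<in>space M. V (LA1 (Suc n)) \<omega> = -1} = 1 - p \<and>
      prob {\<omega>\<in>space M. V (LA2 (Suc n)) \<omega> = 1} = p \<and> prob {\<omega>\<in>space M. V (LA2 (Suc n)) \<omega> = -1} = 1 - p"
begin

definition Y :: "'a \<Rightarrow> nat \<Rightarrow> real" where "Y \<omega> k = walk (\<lambda>i. V i \<omega>) k"

text \<open>The restriction makes this a random element of the product space over
  \<open>past n\<close>, the form in which independence of disjoint groups of labels is
  available.\<close>

definition history :: "nat \<Rightarrow> 'a \<Rightarrow> lbl \<Rightarrow> real" where
  "history n \<omega> = restrict (\<lambda>i. V i \<omega>) (past n)"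

text \<open>The point masses fix the ranges of the primitive variables only almost surely; this is
  the event on which all ranges are respected and pathwise arguments are valid.\<close>

definition good :: "'a \<Rightarrow> bool" where
  "good \<omega> \<longleftrightarrow> (\<forall>k\<in>{1, 2}. V (LX k) \<omega> \<in> {1, -1}) \<and> (\<forall>n\<ge>2.
     V (LU1 (Suc n)) \<omega> \<in> real ` {1..n} \<and> V (LU2 (Suc n)) \<omega> \<in> real ` {1..n} \<and>
     V (LA1 (Suc n)) \<omega> \<in> {1, -1} \<and> V (LA2 (Suc n)) \<omega> \<in> {1, -1})"

lemma V_measurable: "i \<in> prim_index \<Longrightarrow> V i \<in> borel_measurable M"
  using indep by (auto simp: indep_vars_def)

lemma block_measurable:
  "2 \<le> n \<Longrightarrow> V (LU1 (Suc n)) \<in> borel_measurable M" "2 \<le> n \<Longrightarrow> V (LU2 (Suc n)) \<in> borel_measurable M"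
  "2 \<le> n \<Longrightarrow> V (LA1 (Suc n)) \<in> borel_measurable M" "2 \<le> n \<Longrightarrow> V (LA2 (Suc n)) \<in> borel_measurable M"
  by (intro V_measurable; force simp: prim_index_def)+

lemma AE_good: "AE \<omega> in M. good \<omega>"
proof -
  have "AE \<omega> in M. V (LX k) \<omega> \<in> {1, -1}" if "k \<in> {1, 2}" for k
    using that start[OF that] by (intro AE_in_finite_set V_measurable) (auto simp: prim_index_def)
  moreover have "AE \<omega> in M. V (LU1 (Suc n)) \<omega> \<in> real ` {1..n} \<and> V (LU2 (Suc n)) \<omega> \<in> real ` {1..n} \<and>
     V (LA1 (Suc n)) \<omega> \<in> {1, -1} \<and> V (LA2 (Suc n)) \<omega> \<in> {1, -1}" if n: "2 \<le> n" for n
  proof (intro AE_conjI AE_in_finite_set block_measurable n)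
    show "(\<Sum>a\<in>real ` {1..n}. prob {\<omega>\<in>space M. V (LU1 (Suc n)) \<omega> = a}) = 1"
      "(\<Sum>a\<in>real ` {1..n}. prob {\<omega>\<in>space M. V (LU2 (Suc n)) \<omega> = a}) = 1"
      using n memory[OF n] by (simp_all add: sum.reindex)
  qed (use sign[OF n] in auto)
  ultimately show ?thesis
    unfolding good_def by (subst AE_conj_iff, subst AE_ball_countable, simp, subst AE_all_countable) auto
qed

text \<open>When the memory indices lie in range, each indicator sum in \<open>walk\<close>
  collapses to the single remembered step.\<close>

lemma Y_Suc_good:
  assumes "good \<omega>" "2 \<le> n" "V (LU1 (Suc n)) \<omega> = real i" "V (LU2 (Suc n)) \<omega> = real j"
  shows "Y \<omega> (Suc n) = clip (V (LA1 (Suc n)) \<omega> * Y \<omega> i + V (LA2 (Suc n)) \<omega> * Y \<omega> j)"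
proof -
  have "i \<in> {1..n}" "j \<in> {1..n}"
    using assms by (force simp: good_def)+
  then have "(\<Sum>l\<in>{1..<Suc n}. of_bool (real i = real l) * walk v l) = walk v i"
    "(\<Sum>l\<in>{1..<Suc n}. of_bool (real j = real l) * walk v l) = walk v j" for v
    by (auto simp: of_bool_def if_distribR if_distrib sum.delta' cong: if_cong)
  then show ?thesis
    using assms(2-4) unfolding Y_def by (subst walk.simps) (simp del: sum_of_bool_mult_eq)
qed

lemma Y_trinary:
  assumes "good \<omega>" "1 \<le> k"
  shows "Y \<omega> k \<in> {-1, 0, 1}"
  using assms(2)
proof (induction k rule: less_induct)
  case (less k)
  show ?case
  proof (cases "k \<le> 2")
    case True
    then have "k = 1 \<or> k = 2" using less.prems by auto
    then show ?thesis using assms(1) by (auto simp: Y_def walk.simps good_def)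
  next
    case False
    then obtain n where n: "k = Suc n" "2 \<le> n" by (cases k) auto
    with assms(1) obtain i j where ij: "V (LU1 (Suc n)) \<omega> = real i" "V (LU2 (Suc n)) \<omega> = real j"
      "i \<in> {1..n}" "j \<in> {1..n}"
      unfolding good_def by blast
    have "V (LA1 (Suc n)) \<omega> \<in> {1, -1}" "V (LA2 (Suc n)) \<omega> \<in> {1, -1}"
      using assms(1) n by (auto simp: good_def)
    moreover have "Y \<omega> i \<in> {-1, 0, 1}" "Y \<omega> j \<in> {-1, 0, 1}"
      using less.IH ij n by auto
    ultimately have "V (LA1 (Suc n)) \<omega> * Y \<omega> i \<in> {-1, 0, 1}" "V (LA2 (Suc n)) \<omega> * Y \<omega> j \<in> {-1, 0, 1}"
      by auto
    then show ?thesis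
      unfolding n Y_Suc_good[OF assms(1) n(2) ij(1,2)] by (rule clip_trinary)
  qed
qed

lemma history_measurable: "history n \<in> measurable M (PiM (past n) (\<lambda>_. borel))"
  unfolding history_def using past_subset V_measurable by (intro measurable_restrict) auto

lemma Y_eq_history: "k \<le> n \<Longrightarrow> Y \<omega> k = walk (history n \<omega>) k"
  unfolding Y_def history_def by (rule walk_cong[of n]) auto

lemma Y_measurable [measurable]: "(\<lambda>\<omega>. Y \<omega> k) \<in> borel_measurable M"
  unfolding Y_eq_history[OF order.refl]
  by (rule measurable_compose[OF history_measurable walk_measurable]) simp

lemma prob_block:
  assumes n: "2 \<le> n"
  shows "prob {\<omega>\<in>space M. V (LU1 (Suc n)) \<omega> = a \<and> V (LU2 (Suc n)) \<omega> = b \<and>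
      V (LA1 (Suc n)) \<omega> = c \<and> V (LA2 (Suc n)) \<omega> = d} =
    prob {\<omega>\<in>space M. V (LU1 (Suc n)) \<omega> = a} * prob {\<omega>\<in>space M. V (LU2 (Suc n)) \<omega> = b} *
    prob {\<omega>\<in>space M. V (LA1 (Suc n)) \<omega> = c} * prob {\<omega>\<in>space M. V (LA2 (Suc n)) \<omega> = d}"
proof -
  define A where "A i = (case i of LU1 _ \<Rightarrow> {a} | LU2 _ \<Rightarrow> {b} | LA1 _ \<Rightarrow> {c} | LA2 _ \<Rightarrow> {d} | LX _ \<Rightarrow> {})" for i
  have "prob (\<Inter>i\<in>block (Suc n). V i -` A i \<inter> space M) = (\<Prod>i\<in>block (Suc n). prob (V i -` A i \<inter> space M))"
    using n block_subset[of "Suc n"]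
    by (intro indep_varsD[OF indep]) (auto simp: block_def A_def)
  moreover have "(\<Inter>i\<in>block (Suc n). V i -` A i \<inter> space M) = {\<omega>\<in>space M. V (LU1 (Suc n)) \<omega> = a \<and>
      V (LU2 (Suc n)) \<omega> = b \<and> V (LA1 (Suc n)) \<omega> = c \<and> V (LA2 (Suc n)) \<omega> = d}"
    by (auto simp: block_def A_def)
  moreover have "V i -` {x} \<inter> space M = {\<omega>\<in>space M. V i \<omega> = x}" for i x by auto
  ultimately show ?thesis by (simp add: block_def A_def mult.assoc)
qed

text \<open>The label sets \<open>past n\<close> and \<open>block (Suc n)\<close> are disjoint, so
  the new draw is independent of the history and the expectation factorises; the second factor
  splits further by \<open>prob_block\<close>.\<close>

lemma expectation_history_times_block:
  assumes n: "2 \<le> n" and F: "F \<in> borel_measurable (PiM (past n) (\<lambda>_. borel))"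
    and bd: "\<And>v. \<bar>F v\<bar> \<le> B"
  shows "expectation (\<lambda>\<omega>. F (history n \<omega>) * of_bool (V (LU1 (Suc n)) \<omega> = a \<and> V (LU2 (Suc n)) \<omega> = b \<and>
      V (LA1 (Suc n)) \<omega> = c \<and> V (LA2 (Suc n)) \<omega> = d)) =
    expectation (\<lambda>\<omega>. F (history n \<omega>)) *
    (prob {\<omega>\<in>space M. V (LU1 (Suc n)) \<omega> = a} * prob {\<omega>\<in>space M. V (LU2 (Suc n)) \<omega> = b} *
    prob {\<omega>\<in>space M. V (LA1 (Suc n)) \<omega> = c} * prob {\<omega>\<in>space M. V (LA2 (Suc n)) \<omega> = d})"
proof -
  define g :: "(lbl \<Rightarrow> real) \<Rightarrow> real" where
    "g v = of_bool (v (LU1 (Suc n)) = a \<and> v (LU2 (Suc n)) = b \<and> v (LA1 (Suc n)) = c \<and> v (LA2 (Suc n)) = d)" for v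
  let ?N = "\<lambda>\<omega>. restrict (\<lambda>i. V i \<omega>) (block (Suc n))"
  have [measurable]: "LA1 (Suc n) \<in> block (Suc n)" "LA2 (Suc n) \<in> block (Suc n)"
    "LU1 (Suc n) \<in> block (Suc n)" "LU2 (Suc n) \<in> block (Suc n)"
    by (auto simp: block_def)
  have g: "g \<in> borel_measurable (PiM (block (Suc n)) (\<lambda>_. borel))"
    unfolding g_def by measurable
  have N: "?N \<in> measurable M (PiM (block (Suc n)) (\<lambda>_. borel))"
    using block_subset[of "Suc n"] n V_measurable by (intro measurable_restrict) auto
  note [measurable] = measurable_compose[OF history_measurable F] measurable_compose[OF N g] block_measurable[OF n]
  have gN: "g (?N \<omega>) = of_bool (V (LU1 (Suc n)) \<omega> = a \<and> V (LU2 (Suc n)) \<omega> = b \<and>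
      V (LA1 (Suc n)) \<omega> = c \<and> V (LA2 (Suc n)) \<omega> = d)" for \<omega>
    by (simp add: g_def block_def)
  have "indep_var (PiM (past n) (\<lambda>_. borel)) (history n) (PiM (block (Suc n)) (\<lambda>_. borel)) ?N"
    unfolding history_def
    using n by (intro indep_var_restrict[OF indep] past_Int_block past_subset block_subset) auto
  from indep_var_compose[OF this F g]
  have "indep_var borel (\<lambda>\<omega>. F (history n \<omega>)) borel (\<lambda>\<omega>. g (?N \<omega>))" by (simp add: comp_def)
  moreover have "integrable M (\<lambda>\<omega>. F (history n \<omega>))"
    using bd by (intro integrable_const_bound[where B = B]) auto
  moreover have "integrable M (\<lambda>\<omega>. g (?N \<omega>))"
    by (intro integrable_const_bound[where B = 1]) (auto simp: gN)
  ultimately have "expectation (\<lambda>\<omega>. F (history n \<omega>) * g (?N \<omega>)) =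
      expectation (\<lambda>\<omega>. F (history n \<omega>)) * expectation (\<lambda>\<omega>. g (?N \<omega>))"
    by (rule indep_var_lebesgue_integral)
  also have "expectation (\<lambda>\<omega>. g (?N \<omega>)) = prob {\<omega>\<in>space M. V (LU1 (Suc n)) \<omega> = a \<and> V (LU2 (Suc n)) \<omega> = b \<and>
      V (LA1 (Suc n)) \<omega> = c \<and> V (LA2 (Suc n)) \<omega> = d}"
  proof -
    have "expectation (\<lambda>\<omega>. g (?N \<omega>)) = expectation (indicator {\<omega>\<in>space M. V (LU1 (Suc n)) \<omega> = a \<and>
      V (LU2 (Suc n)) \<omega> = b \<and> V (LA1 (Suc n)) \<omega> = c \<and> V (LA2 (Suc n)) \<omega> = d})"
      unfolding gN by (intro Bochner_Integration.integral_cong) (auto simp: indicator_def)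
    then show ?thesis using n block_measurable[OF n] by simp
  qed
  finally show ?thesis unfolding gN prob_block[OF n] .
qed

section \<open>Martingale property of the noise\<close>

lemma level_measurable [measurable]: "(\<lambda>\<omega>. level (Y \<omega>) s n) \<in> borel_measurable M"
  unfolding level_eq_sum by measurable

lemma step_prob_measurable [measurable]: "(\<lambda>\<omega>. step_prob p (Y \<omega>) s n) \<in> borel_measurable M"
  unfolding step_prob_def by measurable

text \<open>The martingale difference property, tested against bounded functions of the history
  instead of through conditional expectations. The expectation is expanded over the finitely many
  values of the new draw, each term is factorised, and the weighted sum is recombined into
  \<open>step_prob\<close>.\<close>

lemma expectation_step:
  assumes n: "2 \<le> n" and F [measurable]: "F \<in> borel_measurable (PiM (past n) (\<lambda>_. borel))"
    and bd: "\<And>v. \<bar>F v\<bar> \<le> B" and s: "s \<in> {-1, 1}"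
  shows "expectation (\<lambda>\<omega>. F (history n \<omega>) * (of_bool (Y \<omega> (Suc n) = s) - step_prob p (Y \<omega>) s n)) = 0"
proof -
  let ?T = "{1..n} \<times> {1, -1 :: real}"
  define w where "w = (\<lambda>a :: real. if a = 1 then p else 1 - p)"
  define ev where "ev i a j b \<omega> \<longleftrightarrow> V (LU1 (Suc n)) \<omega> = real i \<and> V (LU2 (Suc n)) \<omega> = real j \<and>
    V (LA1 (Suc n)) \<omega> = a \<and> V (LA2 (Suc n)) \<omega> = b" for i j a b \<omega>
  \<comment> \<open>With the draw frozen at \<open>(i, a)\<close>, \<open>(j, b)\<close>, the next
    step depends on the history alone, so \<open>Q\<close> can be separated from the event
    \<open>ev\<close>.\<close>
  define Q where "Q i a j b v = F v * of_bool (clip (a * walk v i + b * walk v j) = s)" for i a j b v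
  have Q_meas: "Q i a j b \<in> borel_measurable (PiM (past n) (\<lambda>_. borel))"
    if "i \<in> {1..n}" "j \<in> {1..n}" for i a j b
  proof -
    have [measurable]: "(\<lambda>v. walk v i) \<in> borel_measurable (PiM (past n) (\<lambda>_. borel))"
      "(\<lambda>v. walk v j) \<in> borel_measurable (PiM (past n) (\<lambda>_. borel))"
      using that by (auto intro: walk_measurable)
    show ?thesis unfolding Q_def by measurable
  qed
  have Q_bd: "\<bar>Q i a j b v\<bar> \<le> B" for i a j b v
    using bd[of v] by (auto simp: Q_def of_bool_def)
  note [measurable] = block_measurable[OF n] history_measurable[of n]
    measurable_compose[OF history_measurable Q_meas] measurable_compose[OF history_measurable F]
  have [measurable]: "(\<lambda>\<omega>. Q (fst (fst x)) (snd (fst x)) (fst (snd x)) (snd (snd x)) (history n \<omega>)) \<in> borel_measurable M"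
    if "x \<in> ?T \<times> ?T" for x
    using that by (intro measurable_compose[OF history_measurable Q_meas]) auto
  have Q_int: "integrable M (\<lambda>\<omega>. Q i a j b (history n \<omega>))" if "i \<in> {1..n}" "j \<in> {1..n}" for i a j b
    using Q_bd that by (intro integrable_const_bound[where B = B]) auto
  have Qev_int: "integrable M (\<lambda>\<omega>. Q i a j b (history n \<omega>) * of_bool (ev i a j b \<omega>))"
    if "i \<in> {1..n}" "j \<in> {1..n}" for i a j b
    using that Q_bd order.trans[OF abs_ge_zero bd] unfolding ev_def
    by (intro integrable_const_bound[where B = B]) (auto simp: of_bool_def)
  have F_int: "integrable M (\<lambda>\<omega>. F (history n \<omega>) * of_bool (Y \<omega> (Suc n) = s))"
    using bd order.trans[OF abs_ge_zero bd]
    by (intro integrable_const_bound[where B = B]) (auto simp: of_bool_def)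
  have F_int': "integrable M (\<lambda>\<omega>. F (history n \<omega>) * step_prob p (Y \<omega>) s n)"
  proof (intro integrable_const_bound[where B = B] AE_I2)
    show "norm (F (history n \<omega>) * step_prob p (Y \<omega>) s n) \<le> B" for \<omega>
      using step_prob_bounds[of p s "Y \<omega>" n] p s bd[of "history n \<omega>"]
        mult_mono[of "\<bar>F (history n \<omega>)\<bar>" B "\<bar>step_prob p (Y \<omega>) s n\<bar>" 1]
      by (auto simp: abs_mult)
  qed auto

  have "expectation (\<lambda>\<omega>. F (history n \<omega>) * of_bool (Y \<omega> (Suc n) = s)) =
    expectation (\<lambda>\<omega>. \<Sum>((i, a), (j, b))\<in>?T \<times> ?T. Q i a j b (history n \<omega>) * of_bool (ev i a j b \<omega>))"
  proof (rule integral_cong_AE)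
    show "AE \<omega> in M. F (history n \<omega>) * of_bool (Y \<omega> (Suc n) = s) =
      (\<Sum>((i, a), (j, b))\<in>?T \<times> ?T. Q i a j b (history n \<omega>) * of_bool (ev i a j b \<omega>))"
      using AE_good
    proof eventually_elim
      case (elim \<omega>)
      with n obtain i j where ij: "V (LU1 (Suc n)) \<omega> = real i" "V (LU2 (Suc n)) \<omega> = real j"
        "i \<in> {1..n}" "j \<in> {1..n}"
        unfolding good_def by blast
      let ?a = "V (LA1 (Suc n)) \<omega>" and ?b = "V (LA2 (Suc n)) \<omega>"
      have ab: "?a \<in> {1, -1}" "?b \<in> {1, -1}"
        using elim n by (auto simp: good_def)
      \<comment> \<open>On a good path exactly one draw occurs, so a single summand
        survives.\<close>
      have "(\<Sum>((i', a), (j', b))\<in>?T \<times> ?T. Q i' a j' b (history n \<omega>) * of_bool (ev i' a j' b \<omega>)) =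
        (\<Sum>z\<in>?T \<times> ?T. if z = ((i, ?a), (j, ?b)) then Q i ?a j ?b (history n \<omega>) else 0)"
        by (intro sum.cong) (auto simp: ev_def ij)
      also have "\<dots> = Q i ?a j ?b (history n \<omega>)"
        using ij ab by simp
      also have "\<dots> = F (history n \<omega>) * of_bool (Y \<omega> (Suc n) = s)"
        unfolding Q_def Y_Suc_good[OF elim n ij(1,2)] using ij by (simp add: Y_eq_history[of _ n])
      finally show ?case by simp
    qed
  qed (unfold case_prod_unfold ev_def, measurable)
  also have "\<dots> = (\<Sum>((i, a), (j, b))\<in>?T \<times> ?T. expectation (\<lambda>\<omega>. Q i a j b (history n \<omega>) * of_bool (ev i a j b \<omega>)))"
    unfolding case_prod_unfold using Qev_int
    by (intro Bochner_Integration.integral_sum) auto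
  \<comment> \<open>By independence the indicator of each draw is replaced by its
    probability.\<close>
  also have "\<dots> = (\<Sum>((i, a), (j, b))\<in>?T \<times> ?T. expectation (\<lambda>\<omega>. Q i a j b (history n \<omega>)) * (w a * w b / (real n)\<^sup>2))"
  proof (intro sum.cong refl, clarify)
    fix i j and a b :: real
    assume *: "i \<in> {1..n}" "j \<in> {1..n}" "a \<in> {1, -1}" "b \<in> {1, -1}"
    have "expectation (\<lambda>\<omega>. Q i a j b (history n \<omega>) * of_bool (ev i a j b \<omega>)) =
      expectation (\<lambda>\<omega>. Q i a j b (history n \<omega>)) * (1 / real n * (1 / real n) * w a * w b)"
      unfolding ev_def expectation_history_times_block[OF n Q_meas[OF *(1,2)] Q_bd]
      using memory[OF n *(1)] memory[OF n *(2)] sign[OF n] *(3,4) by (auto simp: w_def)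
    then show "expectation (\<lambda>\<omega>. Q i a j b (history n \<omega>) * of_bool (ev i a j b \<omega>)) =
      expectation (\<lambda>\<omega>. Q i a j b (history n \<omega>)) * (w a * w b / (real n)\<^sup>2)"
      by (simp add: power2_eq_square)
  qed
  also have "\<dots> = expectation (\<lambda>\<omega>. \<Sum>((i, a), (j, b))\<in>?T \<times> ?T. Q i a j b (history n \<omega>) * (w a * w b / (real n)\<^sup>2))"
    unfolding case_prod_unfold using Q_int
    by (subst Bochner_Integration.integral_sum) auto
  also have "\<dots> = expectation (\<lambda>\<omega>. F (history n \<omega>) * step_prob p (Y \<omega>) s n)"
  proof (rule integral_cong_AE)
    show "AE \<omega> in M. (\<Sum>((i, a), (j, b))\<in>?T \<times> ?T. Q i a j b (history n \<omega>) * (w a * w b / (real n)\<^sup>2)) =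
      F (history n \<omega>) * step_prob p (Y \<omega>) s n"
      using AE_good
    proof eventually_elim
      case (elim \<omega>)
      have "step_prob p (Y \<omega>) s n = (\<Sum>((i, a), (j, b))\<in>?T \<times> ?T.
            w a * w b / (real n)\<^sup>2 * of_bool (clip (a * Y \<omega> i + b * Y \<omega> j) = s))"
        unfolding w_def using n Y_trinary[OF elim] s by (intro step_prob_eq_sum [symmetric]) auto
      then have "F (history n \<omega>) * step_prob p (Y \<omega>) s n = (\<Sum>((i, a), (j, b))\<in>?T \<times> ?T.
            F (history n \<omega>) * (w a * w b / (real n)\<^sup>2 * of_bool (clip (a * Y \<omega> i + b * Y \<omega> j) = s)))"
        by (simp only: sum_distrib_left case_prod_unfold)
      also have "\<dots> = (\<Sum>((i, a), (j, b))\<in>?T \<times> ?T. Q i a j b (history n \<omega>) * (w a * w b / (real n)\<^sup>2))"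
        by (intro sum.cong refl) (auto simp: Q_def Y_eq_history[of _ n])
      finally show ?case by (rule sym)
    qed
  qed (unfold case_prod_unfold, measurable)
  finally show ?thesis using F_int F_int' by (simp add: right_diff_distrib)
qed

text \<open>Index \<open>n\<close> carries the noise of step \<open>Suc n\<close>. It is zero below
  \<open>2\<close> because the memory rule first produces step \<open>3\<close>.\<close>

definition noise :: "real \<Rightarrow> nat \<Rightarrow> 'a \<Rightarrow> real" where
  "noise s n \<omega> = (if n < 2 then 0 else of_bool (Y \<omega> (Suc n) = s) - step_prob p (Y \<omega>) s n)"

lemma noise_growth:
  assumes s: "s \<in> {-1, 1}" and \<delta>: "0 < \<delta>"
  shows "AE \<omega> in M. \<forall>\<^sub>F n in sequentially. \<bar>\<Sum>k<n. noise s k \<omega>\<bar> \<le> real n powr (1/2 + \<delta>)"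
proof (rule martingale_growth)
  show meas: "noise s n \<in> borel_measurable M" for n
    unfolding noise_def[abs_def] by measurable
  show bd: "\<bar>noise s n \<omega>\<bar> \<le> 1" for n \<omega>
    using step_prob_bounds[of p s "Y \<omega>" n] p s by (auto simp: noise_def of_bool_def)
  show "expectation (\<lambda>\<omega>. exp (t * (\<Sum>k<n. noise s k \<omega>)) * noise s n \<omega>) = 0" for n t
  proof (cases "n < 2")
    case True
    then show ?thesis by (simp add: noise_def)
  next
    case False
    define N where "N k v = (if k < 2 then 0 else of_bool (walk v (Suc k) = s) - step_prob p (walk v) s k)" for k v
    \<comment> \<open>The exponential weight as a function of the labels. The truncation supplies
      the bound for all \<open>v\<close> that \<open>expectation_step\<close> asks for; on actual
      histories it changes nothing, since each noise term is at most \<open>1\<close> in absolute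
      value.\<close>
    define F where "F v = max 0 (min (exp (\<bar>t\<bar> * real n)) (exp (t * (\<Sum>k<n. N k v))))" for v
    have [measurable]: "(\<lambda>v. walk v k) \<in> borel_measurable (PiM (past n) (\<lambda>_. borel))" if "k \<in> {..n}" for k
      using that by (intro walk_measurable) auto
    have [measurable]: "N k \<in> borel_measurable (PiM (past n) (\<lambda>_. borel))" if "k \<in> {..<n}" for k
    proof -
      have [measurable]: "i \<in> {1..k} \<Longrightarrow> i \<in> {..n}" "Suc k \<in> {..n}" for i using that by auto
      show ?thesis unfolding N_def[abs_def] step_prob_def level_eq_sum by measurable
    qed
    have F_meas: "F \<in> borel_measurable (PiM (past n) (\<lambda>_. borel))"
      unfolding F_def[abs_def] by measurable
    have F_bd: "\<bar>F v\<bar> \<le> exp (\<bar>t\<bar> * real n)" for v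
      by (auto simp: F_def)
    have N: "N k (history n \<omega>) = noise s k \<omega>" if "k < n" for k \<omega>
    proof -
      have "level (walk (history n \<omega>)) u k = level (Y \<omega>) u k" for u
        unfolding level_eq_sum using that
        by (intro arg_cong2[where f = "(/)"] sum.cong refl) (simp add: Y_eq_history[of _ n])
      then show ?thesis using that by (simp add: N_def noise_def step_prob_def Y_eq_history[of "Suc k" n])
    qed
    have "F (history n \<omega>) = exp (t * (\<Sum>k<n. noise s k \<omega>))" for \<omega>
    proof -
      have "\<bar>\<Sum>k<n. noise s k \<omega>\<bar> \<le> (\<Sum>k<n. 1)"
        by (intro order.trans[OF sum_abs] sum_mono bd)
      then have "\<bar>t\<bar> * \<bar>\<Sum>k<n. noise s k \<omega>\<bar> \<le> \<bar>t\<bar> * real n"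
        by (intro mult_left_mono) simp_all
      then have "t * (\<Sum>k<n. noise s k \<omega>) \<le> \<bar>t\<bar> * real n"
        unfolding abs_mult [symmetric] by linarith
      then show ?thesis by (simp add: F_def N min_def max_def)
    qed
    with expectation_step[OF _ F_meas F_bd s] False show ?thesis
      by (simp add: noise_def)
  qed
qed fact

end

section \<open>The drift and the rate of convergence\<close>

definition dh :: "real \<Rightarrow> real \<times> real \<Rightarrow> real \<times> real \<Rightarrow> real \<times> real" where
  "dh p x v =
    (2 * ((1 - p) * fst x + p * snd x - 1) * ((1 - p) * fst v + p * snd v)
       + 2 * (1 - fst x - snd x) * (fst v + snd v) - fst v,
     2 * ((1 - p) * snd x + p * fst x - 1) * ((1 - p) * snd v + p * fst v)
       + 2 * (1 - fst x - snd x) * (fst v + snd v) - snd v)"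

lemma has_derivative_h: "(h p has_derivative dh p x) (at x)"
  unfolding h_def [abs_def] dh_def [abs_def]
  by (auto intro!: derivative_eq_intros simp: fun_eq_iff algebra_simps)

text \<open>Uniqueness of the derivative replaces the choice in \<open>J\<close> by the explicit
  formula.\<close>

lemma J_eq: "J p x = dh p x"
  unfolding J_def by (rule some_equality, rule has_derivative_h) (rule has_derivative_unique[OF _ has_derivative_h])

lemma bounded_linear_dh: "bounded_linear (dh p x)"
  using has_derivative_h by (rule has_derivative_bounded_linear)

text \<open>As \<open>h p\<close> is a quadratic polynomial, the remainder is exactly its quadratic
  part evaluated at \<open>y - g\<close>. Each coordinate is at most \<open>4 * N\<^sup>2\<close>,
  which explains the constant \<open>8\<close>.\<close>

lemma h_quadratic_remainder:
  assumes p: "0 < p" "p < 1"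
  shows "norm (h p y - h p g - dh p g (y - g)) \<le> 8 * (norm (y - g))\<^sup>2"
proof -
  define v where "v = y - g"
  have y: "y = (fst g + fst v, snd g + snd v)" by (simp add: v_def prod_eq_iff)
  define N where "N = norm v"
  have v: "\<bar>fst v\<bar> \<le> N" "\<bar>snd v\<bar> \<le> N"
    using norm_fst_le[of "fst v" "snd v"] norm_snd_le[of "snd v" "fst v"] by (auto simp: N_def)
  have bd: "\<bar>((1 - p) * a + p * b)\<^sup>2 - (a + b)\<^sup>2\<bar> \<le> 4 * N\<^sup>2" if ab: "\<bar>a\<bar> \<le> N" "\<bar>b\<bar> \<le> N" for a b
  proof -
    have "\<bar>(1 - p) * a + p * b\<bar> \<le> (1 - p) * \<bar>a\<bar> + p * \<bar>b\<bar>"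
      using p by (intro order.trans[OF abs_triangle_ineq]) (simp add: abs_mult)
    also have "\<dots> \<le> (1 - p) * N + p * N"
      using p ab by (intro add_mono mult_left_mono) auto
    finally have "((1 - p) * a + p * b)\<^sup>2 \<le> N\<^sup>2"
      by (intro abs_le_square_iff[THEN iffD1] order.trans[OF _ abs_ge_self]) (simp add: algebra_simps)
    moreover have "\<bar>a + b\<bar> \<le> \<bar>2 * N\<bar>" using ab by linarith
    then have "(a + b)\<^sup>2 \<le> (2 * N)\<^sup>2" by (rule abs_le_square_iff[THEN iffD1])
    then have "(a + b)\<^sup>2 \<le> 4 * N\<^sup>2" by (simp add: power_mult_distrib)
    ultimately show ?thesis
      using zero_le_power2[of "(1 - p) * a + p * b"] zero_le_power2[of "a + b"] zero_le_power2[of N]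
      by (intro abs_leI; linarith)
  qed
  have "h p y - h p g - dh p g v =
    (((1 - p) * fst v + p * snd v)\<^sup>2 - (fst v + snd v)\<^sup>2, ((1 - p) * snd v + p * fst v)\<^sup>2 - (snd v + fst v)\<^sup>2)"
    unfolding y by (simp add: h_def dh_def algebra_simps power2_eq_square)
  also have "norm \<dots> \<le> 4 * N\<^sup>2 + 4 * N\<^sup>2"
    using bd[OF v] bd[OF v(2,1)] by (intro order.trans[OF norm_Pair_le] add_mono) auto
  finally show ?thesis by (simp add: v_def N_def)
qed

text \<open>Exchanging the coordinates of \<open>g\<close> exchanges those of \<open>h p g\<close>,
  so the sum of the coordinates of \<open>h p g\<close> is even in the difference of those of
  \<open>g\<close>, and their difference is odd. The latter therefore factors in
  \<open>h_diff\<close>, which makes the zeros computable.\<close>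

lemma h_sum: "fst (h p g) + snd (h p g) = (fst g + snd g) - 3/2 * (fst g + snd g)\<^sup>2 + (2 * p - 1)\<^sup>2 * (fst g - snd g)\<^sup>2 / 2"
  by (simp add: h_def power2_eq_square field_simps)

lemma h_diff: "fst (h p g) - snd (h p g) = (fst g - snd g) * ((2 * p - 1) * (2 - (fst g + snd g)) - 1)"
  by (simp add: h_def power2_eq_square field_simps)

text \<open>If the difference \<open>d\<close> vanishes, a quadratic equation for the sum
  \<open>s\<close> remains. Otherwise the second factor of \<open>h_diff\<close> determines
  \<open>s\<close>, and \<open>h_sum\<close> then determines \<open>d\<close> up to sign.\<close>

lemma finite_zeros_h: "finite {g. h p g = 0}"
proof -
  define q where "q = 2 * p - 1"
  \<comment> \<open>For \<open>q = 0\<close>, division by zero yields \<open>t = 2\<close> and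
    \<open>r = 0\<close>. Spurious candidates do no harm, since only inclusion in a finite set is
    shown.\<close>
  define t where "t = 2 - 1 / q"
  define r where "r = sqrt ((3 * t\<^sup>2 - 2 * t) / q\<^sup>2)"
  let ?D = "{(0, 0), (2/3, 0), (t, r), (t, -r)} :: (real \<times> real) set"
  have "{g. h p g = 0} \<subseteq> (\<lambda>(s, d). ((s + d) / 2, (s - d) / 2)) ` ?D"
  proof clarify
    fix a b assume "h p (a, b) = 0"
    define s where "s = a + b"
    define d where "d = a - b"
    from h_sum[of p "(a, b)"] h_diff[of p "(a, b)"] \<open>h p (a, b) = 0\<close>
    have 1: "s - 3/2 * s\<^sup>2 + q\<^sup>2 * d\<^sup>2 / 2 = 0" and 2: "d * (q * (2 - s) - 1) = 0"
      by (simp_all add: s_def d_def q_def)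
    have "(s, d) \<in> ?D"
    proof (cases "d = 0")
      case True
      with 1 have "s * (1 - 3/2 * s) = 0" by (simp add: power2_eq_square algebra_simps)
      then have "s = 0 \<or> s = 2/3" by auto
      then show ?thesis using True by auto
    next
      case False
      with 2 have qs: "q * (2 - s) = 1" by simp
      then have q: "q \<noteq> 0" by auto
      then have s: "s = t" using qs by (simp add: t_def field_simps)
      have "d\<^sup>2 = (3 * t\<^sup>2 - 2 * t) / q\<^sup>2" using 1 q s by (simp add: field_simps)
      then have "\<bar>d\<bar> = r" by (simp add: r_def flip: real_sqrt_abs)
      then show ?thesis using s by auto
    qed
    then have "(\<lambda>(s, d). ((s + d) / 2, (s - d) / 2)) (s, d) \<in> (\<lambda>(s, d). ((s + d) / 2, (s - d) / 2)) ` ?D"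
      by (rule imageI)
    then show "(a, b) \<in> (\<lambda>(s, d). ((s + d) / 2, (s - d) / 2)) ` ?D"
      by (simp only: s_def d_def prod.case) simp
  qed
  then show ?thesis by (rule finite_subset) simp
qed

section \<open>Eigencoordinates in the plane and measurability on finite sets\<close>

text \<open>Eigenvectors of distinct eigenvalues are independent, so they form a basis; its dual
  functionals are eigenfunctionals of \<open>f\<close>.\<close>

lemma plane_eigen_decomposition:
  fixes f :: "real \<times> real \<Rightarrow> real \<times> real"
  assumes f: "linear f" and v: "v1 \<noteq> 0" "v2 \<noteq> 0" and eig: "f v1 = l1 *\<^sub>R v1" "f v2 = l2 *\<^sub>R v2" "l1 \<noteq> l2"
  obtains w1 w2 :: "real \<times> real \<Rightarrow> real"
  where "bounded_linear w1" "bounded_linear w2" "\<And>x. x = w1 x *\<^sub>R v1 + w2 x *\<^sub>R v2"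
    "\<And>x. w1 (f x) = l1 * w1 x" "\<And>x. w2 (f x) = l2 * w2 x"
proof -
  interpret f: linear f by fact
  define D where "D = fst v1 * snd v2 - snd v1 * fst v2"
  have D: "D \<noteq> 0"
  proof
    assume "D = 0"
    \<comment> \<open>Applying \<open>f\<close> to the relation and subtracting \<open>l2\<close>
      times it leaves \<open>(l1 - l2) * a\<close> times \<open>v1\<close>. A vanishing determinant
      would give two such relations, forcing \<open>v2 = 0\<close>.\<close>
    have *: "a = 0" if "a *\<^sub>R v1 = b *\<^sub>R v2" for a b
    proof -
      have "a *\<^sub>R l1 *\<^sub>R v1 = b *\<^sub>R l2 *\<^sub>R v2"
        using arg_cong[OF that, of f] by (simp add: f.scaleR eig)
      then have "(l1 * a) *\<^sub>R v1 = l2 *\<^sub>R (b *\<^sub>R v2)" by (simp add: mult.commute)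
      then have "((l1 - l2) * a) *\<^sub>R v1 = 0"
        unfolding that [symmetric] by (simp add: algebra_simps)
      then show ?thesis using v eig by simp
    qed
    have "fst v2 *\<^sub>R v1 = fst v1 *\<^sub>R v2" "snd v2 *\<^sub>R v1 = snd v1 *\<^sub>R v2"
      using \<open>D = 0\<close> by (auto simp: D_def prod_eq_iff mult.commute)
    then have "fst v2 = 0" "snd v2 = 0" using * by blast+
    then show False using v by (simp add: prod_eq_iff)
  qed
  \<comment> \<open>Cramer's rule.\<close>
  define w1 where "w1 x = x \<bullet> (snd v2 / D, - fst v2 / D)" for x
  define w2 where "w2 x = x \<bullet> (- snd v1 / D, fst v1 / D)" for x
  have bl: "bounded_linear w1" "bounded_linear w2"
    unfolding w1_def w2_def by (rule bounded_linear_inner_left)+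
  have w1v: "w1 v1 = 1" "w1 v2 = 0" and w2v: "w2 v1 = 0" "w2 v2 = 1"
    using D by (simp_all add: w1_def w2_def inner_prod_def field_simps) (simp_all add: D_def)
  have dec: "x = w1 x *\<^sub>R v1 + w2 x *\<^sub>R v2" for x
  proof (rule prod_eqI)
    have "D * fst x = D * fst (w1 x *\<^sub>R v1 + w2 x *\<^sub>R v2)" "D * snd x = D * snd (w1 x *\<^sub>R v1 + w2 x *\<^sub>R v2)"
      using D by (simp_all add: w1_def w2_def inner_prod_def field_simps) (simp_all add: D_def algebra_simps)
    then show "fst x = fst (w1 x *\<^sub>R v1 + w2 x *\<^sub>R v2)" "snd x = snd (w1 x *\<^sub>R v1 + w2 x *\<^sub>R v2)"
      using D by simp_all
  qed
  interpret w1: bounded_linear w1 by fact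
  interpret w2: bounded_linear w2 by fact
  have fx: "f x = (w1 x * l1) *\<^sub>R v1 + (w2 x * l2) *\<^sub>R v2" for x
    by (subst dec[of x], unfold f.add f.scaleR eig) simp
  have "w1 (f x) = l1 * w1 x" "w2 (f x) = l2 * w2 x" for x
    by (simp_all add: fx w1.add w2.add w1.scaleR w2.scaleR w1v w2v)
  with bl dec show ?thesis by (intro that)
qed

text \<open>The function is a finite sum of indicators with constant coefficients, whatever
  \<open>f\<close> is. It serves for eigenvalues and eigenvectors, whose definitions by
  \<open>GREATEST\<close> and \<open>THE\<close> do not reveal measurability.\<close>

lemma measurable_finite_support:
  fixes f :: "'a :: t2_space \<Rightarrow> 'b :: {second_countable_topology, real_normed_vector}"
  assumes "finite Z"
  shows "(\<lambda>g. if g \<in> Z then f g else 0) \<in> borel_measurable borel"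
proof -
  have "(\<lambda>g. if g \<in> Z then f g else 0) = (\<lambda>g. \<Sum>z\<in>Z. indicat_real {z} g *\<^sub>R f z)"
  proof
    fix g
    have "(\<Sum>z\<in>Z. indicat_real {z} g *\<^sub>R f z) = (\<Sum>z\<in>Z. if g = z then f z else 0)"
      by (intro sum.cong) (auto simp: indicator_def)
    then show "(if g \<in> Z then f g else 0) = (\<Sum>z\<in>Z. indicat_real {z} g *\<^sub>R f z)"
      using assms by simp
  qed
  also have "\<dots> \<in> borel_measurable borel" by measurable
  finally show ?thesis .
qed

section \<open>Convergence of the empirical frequencies\<close>

context memory_walk
begin

definition state :: "'a \<Rightarrow> nat \<Rightarrow> real \<times> real" where
  "state \<omega> n = (level (Y \<omega>) 1 n, level (Y \<omega>) (-1) n)"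

definition total_noise :: "'a \<Rightarrow> nat \<Rightarrow> real \<times> real" where
  "total_noise \<omega> n = (\<Sum>k<n. noise 1 k \<omega>, \<Sum>k<n. noise (-1) k \<omega>)"

lemma state_measurable [measurable]: "(\<lambda>\<omega>. state \<omega> n) \<in> borel_measurable M"
  unfolding state_def by measurable

lemma level_Suc:
  "n > 0 \<Longrightarrow> level y s (Suc n) - level y s n = (of_bool (y (Suc n) = s) - level y s n) / real (Suc n)"
  by (simp add: level_eq_sum field_simps del: sum_of_bool_eq)

text \<open>The coordinates of \<open>h\<close> at the state are \<open>step_prob\<close> minus
  \<open>level\<close>, so adding the noise cancels \<open>step_prob\<close> and leaves the exact
  increment of the running average.\<close>

lemma state_rec:
  assumes "2 \<le> n"
  shows "state \<omega> (Suc n) - state \<omega> n =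
    (1 / real (Suc n)) *\<^sub>R (h p (state \<omega> n) + total_noise \<omega> (Suc n) - total_noise \<omega> n)"
proof -
  have h: "h p (state \<omega> n) = (step_prob p (Y \<omega>) 1 n - level (Y \<omega>) 1 n, step_prob p (Y \<omega>) (-1) n - level (Y \<omega>) (-1) n)"
    by (simp add: h_def state_def step_prob_def algebra_simps power2_eq_square)
  have "total_noise \<omega> (Suc n) - total_noise \<omega> n = (noise 1 n \<omega>, noise (-1) n \<omega>)"
    by (simp add: total_noise_def)
  then have "h p (state \<omega> n) + total_noise \<omega> (Suc n) - total_noise \<omega> n =
      (of_bool (Y \<omega> (Suc n) = 1) - level (Y \<omega>) 1 n, of_bool (Y \<omega> (Suc n) = -1) - level (Y \<omega>) (-1) n)"
    unfolding add_diff_eq [symmetric] using assms by (simp add: h noise_def)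
  then show ?thesis
    using assms level_Suc[of n "Y \<omega>"] by (simp add: state_def)
qed

lemma total_noise_growth:
  assumes "0 < \<delta>"
  shows "AE \<omega> in M. \<forall>\<^sub>F n in sequentially. norm (total_noise \<omega> n) \<le> 2 * real n powr (1/2 + \<delta>)"
  using noise_growth[of 1 \<delta>, simplified, OF assms] noise_growth[of "-1" \<delta>, simplified, OF assms]
proof eventually_elim
  case (elim \<omega>)
  then show ?case
  proof eventually_elim
    case (elim n)
    have "norm (total_noise \<omega> n) \<le> \<bar>\<Sum>k<n. noise 1 k \<omega>\<bar> + \<bar>\<Sum>k<n. noise (-1) k \<omega>\<bar>"
      unfolding total_noise_def using norm_Pair_le by (metis real_norm_def)
    then show ?case using elim by linarith
  qed
qed

text \<open>An exponent \<open>b < 1\<close> makes the averaged noise vanish, while the drift tends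
  to \<open>h p g\<close> by continuity. The scalar criterion is then applied in each
  coordinate.\<close>

lemma limit_is_zero:
  assumes lim: "state \<omega> \<longlonglongrightarrow> g"
    and noise: "\<forall>\<^sub>F n in sequentially. norm (total_noise \<omega> n) \<le> K * real n powr b" and b: "b < 1"
  shows "h p g = 0"
proof -
  have "(\<lambda>n. (1 / real n) *\<^sub>R total_noise \<omega> n) \<longlonglongrightarrow> 0"
  proof (rule tendsto_0_le[where K = 1])
    show "(\<lambda>n. K * real n powr (b - 1)) \<longlonglongrightarrow> 0" using b by real_asymp
    show "\<forall>\<^sub>F n in sequentially. norm ((1 / real n) *\<^sub>R total_noise \<omega> n) \<le> norm (K * real n powr (b - 1)) * 1"
      using noise eventually_gt_at_top[of 0]
    proof eventually_elim
      case (elim n)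
      then have "norm ((1 / real n) *\<^sub>R total_noise \<omega> n) \<le> K * real n powr b / real n"
        by (simp add: field_simps)
      also have "\<dots> = K * real n powr (b - 1)" using elim by (simp add: powr_diff)
      finally show ?case by (auto intro: order.trans[OF _ abs_ge_self])
    qed
  qed
  from tendsto_fst[OF this] tendsto_snd[OF this]
  have S: "(\<lambda>n. (1 / real n) *\<^sub>R fst (total_noise \<omega> n)) \<longlonglongrightarrow> 0"
    "(\<lambda>n. (1 / real n) *\<^sub>R snd (total_noise \<omega> n)) \<longlonglongrightarrow> 0"
    by simp_all
  have "(\<lambda>n. h p (state \<omega> n)) \<longlonglongrightarrow> h p g"
    using has_derivative_continuous[OF has_derivative_h] lim by (rule isCont_tendsto_compose)
  then have c: "(\<lambda>n. fst (h p (state \<omega> n))) \<longlonglongrightarrow> fst (h p g)" "(\<lambda>n. snd (h p (state \<omega> n))) \<longlonglongrightarrow> snd (h p g)"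
    by (rule tendsto_fst, rule tendsto_snd)
  have x: "convergent (\<lambda>n. fst (state \<omega> n))" "convergent (\<lambda>n. snd (state \<omega> n))"
    using tendsto_fst[OF lim] tendsto_snd[OF lim] by (auto simp: convergent_def)
  have rec: "\<forall>\<^sub>F n in sequentially. state \<omega> (Suc n) - state \<omega> n =
    (1 / real (Suc n)) *\<^sub>R (h p (state \<omega> n) + total_noise \<omega> (Suc n) - total_noise \<omega> n)"
    using eventually_ge_at_top[of 2] by eventually_elim (rule state_rec)
  have "\<forall>\<^sub>F n in sequentially. fst (state \<omega> (Suc n)) - fst (state \<omega> n) =
      (1 / real (Suc n)) *\<^sub>R (fst (h p (state \<omega> n)) + fst (total_noise \<omega> (Suc n)) - fst (total_noise \<omega> n))"
    using rec by eventually_elim (drule arg_cong[where f = fst], simp)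
  from stochastic_approximation_drift_zero[OF this x(1) c(1) S(1)] have "fst (h p g) = 0" .
  moreover have "\<forall>\<^sub>F n in sequentially. snd (state \<omega> (Suc n)) - snd (state \<omega> n) =
      (1 / real (Suc n)) *\<^sub>R (snd (h p (state \<omega> n)) + snd (total_noise \<omega> (Suc n)) - snd (total_noise \<omega> n))"
    using rec by eventually_elim (drule arg_cong[where f = snd], simp)
  from stochastic_approximation_drift_zero[OF this x(2) c(2) S(2)] have "snd (h p g) = 0" .
  ultimately show ?thesis by (simp add: prod_eq_iff)
qed

text \<open>The general rate theorem with \<open>m = - l1\<close>, \<open>m' = - l2\<close> and
  \<open>\<beta> = 1/2 - \<delta>\<close>; the condition \<open>\<delta> < 1/2 + l1\<close> is
  exactly \<open>m < \<beta>\<close>.\<close>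

lemma rate_of_convergence:
  assumes lim: "state \<omega> \<longlonglongrightarrow> g" and g: "h p g = 0"
    and eig: "is_eigenvalue (J p g) l1" "is_eigenvalue (J p g) l2" "l2 < -1/2" "-1/2 < l1" "l1 < 0"
    and noise: "\<forall>\<^sub>F n in sequentially. norm (total_noise \<omega> n) \<le> K * real n powr (1/2 + \<delta>)"
    and \<delta>: "0 < \<delta>" "\<delta> < 1/2 + l1"
  shows "convergent (\<lambda>n. real n powr (- l1) *\<^sub>R (state \<omega> n - g))"
proof -
  obtain v1 v2 where v: "v1 \<noteq> 0" "v2 \<noteq> 0" "dh p g v1 = l1 *\<^sub>R v1" "dh p g v2 = l2 *\<^sub>R v2"
    using eig(1,2) unfolding is_eigenvalue_def J_eq by blast
  have "l1 \<noteq> l2" using eig by linarith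
  from plane_eigen_decomposition[OF bounded_linear.linear[OF bounded_linear_dh] v this]
  obtain w1 w2 :: "real \<times> real \<Rightarrow> real"
    where w: "bounded_linear w1" "bounded_linear w2" "\<And>x. x = w1 x *\<^sub>R v1 + w2 x *\<^sub>R v2"
      "\<And>x. w1 (dh p g x) = l1 * w1 x" "\<And>x. w2 (dh p g x) = l2 * w2 x"
    by blast
  show ?thesis
  proof (rule stochastic_approximation_rate[where ?w1.0 = w1 and ?w2.0 = w2 and ?e1.0 = v1 and ?e2.0 = v2
        and f = "dh p g" and m' = "- l2" and \<beta> = "1/2 - \<delta>" and H = "h p" and C = 8])
    show "\<forall>\<^sub>F n in sequentially. state \<omega> (Suc n) - state \<omega> n =
      (1 / real (Suc n)) *\<^sub>R (h p (state \<omega> n) + total_noise \<omega> (Suc n) - total_noise \<omega> n)"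
      using eventually_ge_at_top[of 2] by eventually_elim (rule state_rec)
    show "norm (h p y - dh p g (y - g)) \<le> 8 * (norm (y - g))\<^sup>2" for y
      using h_quadratic_remainder[OF p, of y g] g by simp
    show "\<forall>\<^sub>F n in sequentially. norm (total_noise \<omega> n) \<le> K * real n powr (1 - (1/2 - \<delta>))"
      using noise by simp
    show "w1 (dh p g v) = - (- l1) * w1 v" "w2 (dh p g v) = - (- l2) * w2 v" for v
      using w(4,5) by simp_all
    show "v = w1 v *\<^sub>R v1 + w2 v *\<^sub>R v2" for v by (rule w(3))
  qed (use w(1,2) lim eig \<delta> bounded_linear_dh in simp_all)
qed

text \<open>Here \<open>c\<close>, \<open>l1\<close> and \<open>l2\<close> are arbitrary functions.
  Almost surely \<open>G\<close> lies in the finite zero set of \<open>h\<close>, so cutting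
  \<open>c\<close> and \<open>l1\<close> off outside that set makes them measurable without changing
  the quotient almost surely.\<close>

lemma AE_rate_of_convergence:
  fixes G :: "'a \<Rightarrow> real \<times> real" and c :: "real \<times> real \<Rightarrow> real \<times> real" and l1 l2 :: "real \<times> real \<Rightarrow> real"
  assumes G: "G \<in> borel_measurable M" and lim: "AE \<omega> in M. state \<omega> \<longlonglongrightarrow> G \<omega>"
    and eig: "AE \<omega> in M. is_eigenvalue (J p (G \<omega>)) (l1 (G \<omega>)) \<and> is_eigenvalue (J p (G \<omega>)) (l2 (G \<omega>)) \<and>
        l2 (G \<omega>) < -1/2 \<and> -1/2 < l1 (G \<omega>) \<and> l1 (G \<omega>) < 0"
  shows "\<exists>L. L \<in> borel_measurable M \<and>
    (AE \<omega> in M. (\<lambda>n. (c (G \<omega>) \<bullet> (state \<omega> n - G \<omega>)) / real n powr l1 (G \<omega>)) \<longlonglongrightarrow> L \<omega>)"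
proof -
  define Z where "Z = {g. h p g = 0}"
  define c' where "c' g = (if g \<in> Z then c g else 0)" for g
  define l' where "l' g = (if g \<in> Z then l1 g else 0)" for g
  define \<Phi> where "\<Phi> n \<omega> = (c' (G \<omega>) \<bullet> (state \<omega> n - G \<omega>)) / real n powr l' (G \<omega>)" for n \<omega>
  note G [measurable]
  have [measurable]: "c' \<in> borel_measurable borel" "l' \<in> borel_measurable borel"
    unfolding c'_def [abs_def] l'_def [abs_def] Z_def
    by (intro measurable_finite_support finite_zeros_h)+
  have meas: "\<Phi> n \<in> borel_measurable M" for n
    unfolding \<Phi>_def [abs_def] by measurable
  \<comment> \<open>The admissible \<open>\<delta>\<close> depends on the random eigenvalue, so one
    null set must serve a sequence of values tending to zero. The offset \<open>3\<close> keeps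
    \<open>1/2 + \<delta>\<close> below \<open>1\<close> already for \<open>m = 0\<close>, as
    \<open>limit_is_zero\<close> demands.\<close>
  have noise: "AE \<omega> in M. \<forall>m. \<forall>\<^sub>F n in sequentially. norm (total_noise \<omega> n) \<le> 2 * real n powr (1/2 + 1 / real (m + 3))"
    unfolding AE_all_countable by (intro allI total_noise_growth) simp
  have "AE \<omega> in M. (\<lambda>n. (c (G \<omega>) \<bullet> (state \<omega> n - G \<omega>)) / real n powr l1 (G \<omega>)) \<longlonglongrightarrow> lim (\<lambda>n. \<Phi> n \<omega>)"
    using lim eig noise
  proof eventually_elim
    case (elim \<omega>)
    have zero: "h p (G \<omega>) = 0"
      using elim(1) elim(3)[rule_format, of 0] by (rule limit_is_zero) simp
    from elim(2) have "0 < 1/2 + l1 (G \<omega>)" by linarith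
    then obtain m where m: "1 / real (Suc m) < 1/2 + l1 (G \<omega>)"
      using nat_approx_posE by blast
    have "1 / real (m + 3) \<le> 1 / real (Suc m)" by (intro divide_left_mono) auto
    with m have "convergent (\<lambda>n. real n powr (- l1 (G \<omega>)) *\<^sub>R (state \<omega> n - G \<omega>))"
      using elim zero by (intro rate_of_convergence[OF elim(1), where \<delta> = "1 / real (m + 3)" and ?l2.0 = "l2 (G \<omega>)" and K = 2]) auto
    then obtain D where "(\<lambda>n. real n powr (- l1 (G \<omega>)) *\<^sub>R (state \<omega> n - G \<omega>)) \<longlonglongrightarrow> D"
      by (auto simp: convergent_def)
    then have "(\<lambda>n. c (G \<omega>) \<bullet> (real n powr (- l1 (G \<omega>)) *\<^sub>R (state \<omega> n - G \<omega>))) \<longlonglongrightarrow> c (G \<omega>) \<bullet> D"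
      by (intro tendsto_intros)
    then have *: "(\<lambda>n. (c (G \<omega>) \<bullet> (state \<omega> n - G \<omega>)) / real n powr l1 (G \<omega>)) \<longlonglongrightarrow> c (G \<omega>) \<bullet> D"
      by (simp add: powr_minus divide_inverse mult.commute)
    then have "(\<lambda>n. \<Phi> n \<omega>) \<longlonglongrightarrow> c (G \<omega>) \<bullet> D"
      using zero by (simp add: \<Phi>_def c'_def l'_def Z_def)
    then have "lim (\<lambda>n. \<Phi> n \<omega>) = c (G \<omega>) \<bullet> D" by (rule limI)
    with * show ?case by simp
  qed
  \<comment> \<open>The candidate limit is defined at every point by \<open>lim\<close>, and is
    measurable even where the sequence diverges.\<close>
  moreover have "(\<lambda>\<omega>. lim (\<lambda>n. \<Phi> n \<omega>)) \<in> borel_measurable M"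
    using meas by (rule borel_measurable_lim_metric)
  ultimately show ?thesis by blast
qed

end

section \<open>Transfer to the given process\<close>

theorem theorem4p9:
  fixes M :: "'a measure"
    and X :: "nat \<Rightarrow> 'a \<Rightarrow> real"
    and U1 U2 :: "nat \<Rightarrow> 'a \<Rightarrow> nat"
    and A1 A2 :: "nat \<Rightarrow> 'a \<Rightarrow> real"
    and G :: "'a \<Rightarrow> real \<times> real"
    and p c1 c2 :: real
  assumes "prob_space M"
    and p: "0 < p" "p < 1" "p \<noteq> 7/8"
    and indep: "prob_space.indep_vars M (\<lambda>_. borel) (prim_vars X U1 U2 A1 A2) prim_index"
    and X12: "\<And>k. k \<in> {1, 2} \<Longrightarrow>
                 measure M {\<omega>\<in>space M. X k \<omega> = 1} = 1/2 \<and> measure M {\<omega>\<in>space M. X k \<omega> = -1} = 1/2"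
    and U: "\<And>n k. 2 \<le> n \<Longrightarrow> k \<in> {1..n} \<Longrightarrow>
                 measure M {\<omega>\<in>space M. U1 (Suc n) \<omega> = k} = 1 / real n \<and>
                 measure M {\<omega>\<in>space M. U2 (Suc n) \<omega> = k} = 1 / real n"
    and A: "\<And>n. 2 \<le> n \<Longrightarrow>
                 measure M {\<omega>\<in>space M. A1 (Suc n) \<omega> = 1} = p \<and> measure M {\<omega>\<in>space M. A1 (Suc n) \<omega> = -1} = 1 - p \<and>
                 measure M {\<omega>\<in>space M. A2 (Suc n) \<omega> = 1} = p \<and> measure M {\<omega>\<in>space M. A2 (Suc n) \<omega> = -1} = 1 - p"
    and rec: "\<And>n \<omega>. 2 \<le> n \<Longrightarrow> \<omega> \<in> space M \<Longrightarrow>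
                 X (Suc n) \<omega> = clip (A1 (Suc n) \<omega> * X (U1 (Suc n) \<omega>) \<omega> + A2 (Suc n) \<omega> * X (U2 (Suc n) \<omega>) \<omega>)"
    and G_meas: "G \<in> borel_measurable M"
    and G_lim: "AE \<omega> in M. (\<lambda>n. Gamma_n X n \<omega>) \<longlonglongrightarrow> G \<omega>"
    and eig: "AE \<omega> in M. is_eigenvalue (J p (G \<omega>)) (lambda1 p (G \<omega>)) \<and>
                          is_eigenvalue (J p (G \<omega>)) (lambda2 p (G \<omega>)) \<and>
                          lambda2 p (G \<omega>) < -1/2 \<and> -1/2 < lambda1 p (G \<omega>) \<and> lambda1 p (G \<omega>) < 0"
  shows "\<exists>L :: 'a \<Rightarrow> real. L \<in> borel_measurable M \<and>
           (AE \<omega> in M. (\<lambda>n. ((c1 *\<^sub>R nu1 p (G \<omega>) + c2 *\<^sub>R nu2 p (G \<omega>)) \<bullet> (Gamma_n X n \<omega> - G \<omega>))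
                               / real n powr lambda1 p (G \<omega>)) \<longlonglongrightarrow> L \<omega>)"
proof -
  define V where "V = prim_vars X U1 U2 A1 A2"
  have V: "V (LX k) \<omega> = X k \<omega>" "V (LU1 k) \<omega> = real (U1 k \<omega>)" "V (LU2 k) \<omega> = real (U2 k \<omega>)"
    "V (LA1 k) \<omega> = A1 k \<omega>" "V (LA2 k) \<omega> = A2 k \<omega>" for k \<omega>
    by (simp_all add: V_def prim_vars_def)
  interpret memory_walk M V p
  proof (intro memory_walk.intro memory_walk_axioms.intro \<open>prob_space M\<close> p)
    show "prob_space.indep_vars M (\<lambda>_. borel) V prim_index" unfolding V_def by (rule indep)
  qed (use X12 U A in \<open>simp_all add: V\<close>)
  \<comment> \<open>On good paths the memory indices stay in range, so \<open>X\<close> never refers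
    to \<open>X 0\<close> and obeys the same recursion as \<open>Y\<close>.\<close>
  have X_eq: "X k \<omega> = Y \<omega> k" if "good \<omega>" "\<omega> \<in> space M" "1 \<le> k" for k \<omega>
    using that(3)
  proof (induction k rule: less_induct)
    case (less k)
    show ?case
    proof (cases "k \<le> 2")
      case True
      then show ?thesis using less.prems by (simp add: Y_def walk.simps V)
    next
      case False
      then obtain n where n: "k = Suc n" "2 \<le> n" by (cases k) auto
      have "U1 (Suc n) \<omega> \<in> {1..n}" "U2 (Suc n) \<omega> \<in> {1..n}"
        using that(1) n by (auto simp: good_def V image_iff)
      then have "X (U1 (Suc n) \<omega>) \<omega> = Y \<omega> (U1 (Suc n) \<omega>)" "X (U2 (Suc n) \<omega>) \<omega> = Y \<omega> (U2 (Suc n) \<omega>)"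
        using less.IH n by auto
      then show ?thesis
        unfolding n rec[OF n(2) that(2)] Y_Suc_good[OF that(1) n(2) V(2,3)] by (simp add: V)
    qed
  qed
  have Gamma: "AE \<omega> in M. \<forall>n. Gamma_n X n \<omega> = state \<omega> n"
    using AE_good AE_space
  proof eventually_elim
    case (elim \<omega>)
    have "{k\<in>{1..n}. X k \<omega> = s} = {k\<in>{1..n}. Y \<omega> k = s}" for n s
      using X_eq[OF elim] by auto
    then show ?case by (simp add: Gamma_n_def state_def level_def)
  qed
  have lim: "AE \<omega> in M. state \<omega> \<longlonglongrightarrow> G \<omega>"
    using Gamma G_lim by eventually_elim simp
  \<comment> \<open>The combination of eigenvectors enters as a function of the limit point,
    evaluated at \<open>G \<omega>\<close>.\<close>
  from AE_rate_of_convergence[OF G_meas lim eig, of "\<lambda>g. c1 *\<^sub>R nu1 p g + c2 *\<^sub>R nu2 p g"]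
  obtain L where L: "L \<in> borel_measurable M" "AE \<omega> in M. (\<lambda>n. ((c1 *\<^sub>R nu1 p (G \<omega>) + c2 *\<^sub>R nu2 p (G \<omega>)) \<bullet> (state \<omega> n - G \<omega>))
      / real n powr lambda1 p (G \<omega>)) \<longlonglongrightarrow> L \<omega>"
    by blast
  have "AE \<omega> in M. (\<lambda>n. ((c1 *\<^sub>R nu1 p (G \<omega>) + c2 *\<^sub>R nu2 p (G \<omega>)) \<bullet> (Gamma_n X n \<omega> - G \<omega>))
      / real n powr lambda1 p (G \<omega>)) \<longlonglongrightarrow> L \<omega>"
    using L(2) Gamma by eventually_elim simp
  with L(1) show ?thesis by blast
qed

end
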